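(* Let $f_n$ be the number of $(123,132)$-sortable permutations of length $n$. Let $g_n$ be the number of $(123,132)$-sortable permutations of length $n$ with at least two left-to-right minima and for which the first block $B_1$ in the ltr-min decomposition is empty. Let $h_n$ be the number of permutations $\pi$ in $\mathfrak{S}_n(\xi,{*}213)$ such that $\pi_2=1$. Let $\mathfrak{c}_n=\frac{1}{n+1}\binom{2n}{n}$. Then: \begin{enumerate} \item $h_1=0$ and $h_{n+1}=\mathfrak{c}_n$, for each $n\ge 1$. \item $g_1=0$ and $g_{n+1}=\mathfrak{c}_{n+1}-\mathfrak{c}_n$, for each $n\ge 1$. \item $f_n=\mathfrak{c}_n$, for each $n\ge 1$. \end{enumerate}
   Context: The ltr-min decomposition of a permutation $\pi$ is $\pi=m_1B_1m_2B_2\cdots m_tB_t$, where $m_1>\dots>m_t$ are the left-to-right minima of $\pi$ (entries smaller than all preceding entries) and $B_i$ is the (possibly empty) block of entries strictly between $m_i$ and $m_{i+1}$ (following $m_t$, for $i=t$). $\xi$ is the bivincular pattern $(132,\{0,2\},\emptyset)$: $\pi=\pi_1\cdots\pi_n$ contains $\xi$ if there is an index $i\ge 2$ with $i+1\le n$ and $\pi_1<\pi_{i+1}<\pi_i$. An occurrence of ${*}213$ is an occurrence of one of the classical patterns $4213$, $3214$, $2314$, $1324$; equivalently, $\pi$ avoids ${*}213$ if and only if $\pi_2\cdots\pi_n$ avoids the classical pattern $213$. $\mathfrak{S}_n(\xi,{*}213)$ is the set of permutations of length $n$ avoiding both $\xi$ and ${*}213$. For a set $\Sigma$ of permutations of length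 at least $2$, the $\Sigma$-stack acts on an input permutation $\pi=\pi_1\cdots\pi_n$ as follows (starting with empty stack and output). For $i=1,\dots,n$: as long as pushing $\pi_i$ on top of the stack would make the content of the stack, read from top to bottom, contain an occurrence of some $\sigma\in\Sigma$ (a subsequence order isomorphic to $\sigma$), pop the top element and append it to the output; then push $\pi_i$. After all letters have been pushed, pop all remaining elements, from top to bottom, appending them to the output. The resulting output is denoted $\mathcal{S}^{\Sigma}(\pi)$. The permutation $\pi$ of length $n$ is $\Sigma$-sortable if $\mathcal{S}^{21}(\mathcal{S}^{\Sigma}(\pi))=12\cdots n$, where $\mathcal{S}^{21}=\mathcal{S}^{\{21\}}$. For $\Sigma=\{\sigma,\tau\}$ one writes $(\sigma,\tau)$-sortable. *)

theory Defs
  imports Complex_Main "HOL-Library.Sublist" "HOL-Combinatorics.Multiset_Permutations"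
begin

text \<open>
  A permutation of length \<open>n\<close> is written in one-line notation, as an element of
  \<open>permutations_of_set {1..n}\<close>.  Lists are indexed from 0, so the entry \<open>\<pi>\<^sub>i\<close> is \<open>\<pi> ! (i - 1)\<close>.
\<close>

definition order_isomorphic :: "nat list \<Rightarrow> nat list \<Rightarrow> bool" where
  "order_isomorphic xs ys \<longleftrightarrow>
     length xs = length ys \<and>
     (\<forall>i<length xs. \<forall>j<length xs. xs ! i < xs ! j \<longleftrightarrow> ys ! i < ys ! j)"

definition contains_pattern :: "nat list \<Rightarrow> nat list \<Rightarrow> bool" where
  "contains_pattern \<pi> \<sigma> \<longleftrightarrow> (\<exists>ys. subseq ys \<pi> \<and> order_isomorphic ys \<sigma>)"

text \<open>
  The stack is a list whose head is the top.  \<open>push \<Sigma> x (s, out)\<close> pops into the output as long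
  as placing \<open>x\<close> on top would create a pattern of \<open>\<Sigma>\<close> and then pushes \<open>x\<close>.  As patterns have
  length at least 2, pushing onto the empty stack never creates one.
\<close>

fun push :: "nat list set \<Rightarrow> nat \<Rightarrow> nat list \<times> nat list \<Rightarrow> nat list \<times> nat list" where
  "push \<Sigma> x ([], out) = ([x], out)"
| "push \<Sigma> x (y # s, out) =
     (if \<exists>\<sigma>\<in>\<Sigma>. contains_pattern (x # y # s) \<sigma> then push \<Sigma> x (s, out @ [y])
      else (x # y # s, out))"

definition stack_output :: "nat list set \<Rightarrow> nat list \<Rightarrow> nat list" where
  "stack_output \<Sigma> \<pi> = (let (s, out) = fold (push \<Sigma>) \<pi> ([], []) in out @ s)"

definition sortable :: "nat list set \<Rightarrow> nat list \<Rightarrow> bool" where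
  "sortable \<Sigma> \<pi> \<longleftrightarrow> stack_output {[2, 1]} (stack_output \<Sigma> \<pi>) = [1..<length \<pi> + 1]"

definition ltr_min_positions :: "nat list \<Rightarrow> nat list" where
  "ltr_min_positions \<pi> = filter (\<lambda>i. \<forall>j<i. \<pi> ! i < \<pi> ! j) [0..<length \<pi>]"

text \<open>
  For \<open>1 \<le> i \<le> t\<close>, where \<open>t\<close> is the number of left-to-right minima, \<open>ltr_block \<pi> i\<close> is the block
  \<open>B\<^sub>i\<close> of the decomposition \<open>m\<^sub>1 B\<^sub>1 \<dots> m\<^sub>t B\<^sub>t\<close>; the end of the list delimits the last block.
\<close>

definition ltr_block :: "nat list \<Rightarrow> nat \<Rightarrow> nat list" where
  "ltr_block \<pi> i =
     (let ps = ltr_min_positions \<pi> @ [length \<pi>] in nths \<pi> {ps ! (i - 1)<..<ps ! i})"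

text \<open>
  The bivincular pattern \<open>(132, {0,2}, \<emptyset>)\<close>: an occurrence \<open>\<pi>\<^sub>1 \<pi>\<^sub>i \<pi>\<^sub>i\<^sub>+\<^sub>1\<close> of 132.
\<close>

definition contains_xi :: "nat list \<Rightarrow> bool" where
  "contains_xi \<pi> \<longleftrightarrow>
     (\<exists>i\<ge>2. i + 1 \<le> length \<pi> \<and> \<pi> ! 0 < \<pi> ! i \<and> \<pi> ! i < \<pi> ! (i - 1))"

definition contains_star213 :: "nat list \<Rightarrow> bool" where
  "contains_star213 \<pi> \<longleftrightarrow>
     (\<exists>\<sigma>\<in>{[4,2,1,3], [3,2,1,4], [2,3,1,4], [1,3,2,4]}. contains_pattern \<pi> \<sigma>)"

definition av_xi_star213 :: "nat \<Rightarrow> nat list set" where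
  "av_xi_star213 n =
     {\<pi> \<in> permutations_of_set {1..n}. \<not> contains_xi \<pi> \<and> \<not> contains_star213 \<pi>}"

definition f_count :: "nat \<Rightarrow> nat" where
  "f_count n = card {\<pi> \<in> permutations_of_set {1..n}. sortable {[1,2,3], [1,3,2]} \<pi>}"

definition g_count :: "nat \<Rightarrow> nat" where
  "g_count n = card {\<pi> \<in> permutations_of_set {1..n}. sortable {[1,2,3], [1,3,2]} \<pi> \<and>
     length (ltr_min_positions \<pi>) \<ge> 2 \<and> ltr_block \<pi> 1 = []}"

definition h_count :: "nat \<Rightarrow> nat" where
  "h_count n = card {\<pi> \<in> av_xi_star213 n. length \<pi> \<ge> 2 \<and> \<pi> ! 1 = 1}"

definition catalan :: "nat \<Rightarrow> real" where
  "catalan n = 1 / (real n + 1) * real ((2 * n) choose n)"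

end

theory Submission
  imports Defs "HOL-Computational_Algebra.Formal_Power_Series"
begin

text \<open>
  Write a permutation as \<open>\<pi> = k\<rho>\<close>.  The heart of the matter is that \<open>\<pi>\<close> is sortable if and only if
  the tail \<open>\<rho>\<close> avoids 213 and every descent of \<open>\<rho>\<close> ends below \<open>k\<close> (\<open>sortable_iff\<close>); these two
  conditions say that \<open>\<pi>\<close> avoids \<open>*213\<close> and \<open>\<xi>\<close>, respectively.

  For the reason, note that pushing \<open>x\<close> onto the first stack pops until at most one larger entry is
  left.  A stack holding only \<open>k\<close> therefore accepts everything, so \<open>k\<close> stays at the bottom and the output is
  \<open>Ok\<close> for some word \<open>O\<close>.  The second stack turns \<open>Ok\<close> into the identity iff \<open>O\<close> is decreasing: entries in
  front of 1 must wait for 1 and hence be decreasing, and 1 is either \<open>k\<close> itself or the last letter of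
  \<open>O\<close>, since it clears the first stack down to \<open>k\<close> and then stays directly above \<open>k\<close>.  It remains to
  see when \<open>O\<close> is decreasing (\<open>fold_push_decreasing_iff\<close>).  An entry \<open>x < k\<close> removes all larger entries
  above \<open>k\<close>.  An entry \<open>x > k\<close> does not: if the entry just before it is larger, one larger
  entry remains below \<open>x\<close>, and \<open>O\<close> is spoilt for good.  As long as this does not happen the stack is an
  ordinary sorting stack above \<open>k\<close>, and Knuth's theorem (with the order reversed) gives the condition 213.

  For the enumeration, a nonempty tail with minimum \<open>v\<close> that avoids 213 has the form \<open>\<rho> = A v B\<close> with all entries of
  \<open>A\<close> above those of \<open>B\<close>, and if \<open>v < k\<close> the condition on descents splits into the ones for \<open>A\<close>
  and \<open>B\<close>.  Hence the number of tails depends only on their length \<open>m\<close> and on the number \<open>j\<close> of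
  entries below \<open>k\<close>, and it obeys the recursion of \<open>ballot m j\<close> (\<open>card_tails\<close>).  On the diagonal this
  is the Catalan convolution (\<open>ballot_diagonal\<close>), and the row sums are again Catalan numbers
  (\<open>ballot_row_sum\<close>).  Summing over \<open>k\<close> yields \<open>f\<close>.  For \<open>h\<close>, deleting the letter 1 leads to the same
  row sum.  For \<open>g\<close> one removes from the sortable permutations those with \<open>\<pi>\<^sub>1 < \<pi>\<^sub>2\<close>, which are as
  numerous as the sortable permutations that are one letter shorter (\<open>card_tails_hd_above\<close>).
\<close>

section \<open>Tails avoiding 213 and their descents\<close>

text \<open>
  A recursive form suits the proofs by induction on words below; the link with subsequences is
  \<open>avoids213_iff_subseq\<close>.
\<close>

primrec avoids213 :: "nat list \<Rightarrow> bool" where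
  "avoids213 [] \<longleftrightarrow> True"
| "avoids213 (x # xs) \<longleftrightarrow> sorted_wrt (\<lambda>a c. \<not> (a < x \<and> x < c)) xs \<and> avoids213 xs"

text \<open>
  In a word with distinct letters other than \<open>k\<close> this forbids exactly the occurrences of \<open>\<xi>\<close> in the
  word with \<open>k\<close> put in front.
\<close>

abbreviation descents_into :: "nat \<Rightarrow> nat list \<Rightarrow> bool" where
  "descents_into k \<equiv> successively (\<lambda>x y. y < x \<longrightarrow> y < k)"

lemma sorted_wrt_if_all: "(\<And>x y. x \<in> set xs \<Longrightarrow> y \<in> set xs \<Longrightarrow> P x y) \<Longrightarrow> sorted_wrt P xs"
  by (induction xs) auto

lemma set_subseq: "subseq xs ys \<Longrightarrow> set xs \<subseteq> set ys"
  by (auto elim: list_emb_set)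

lemma sorted_wrt_iff_subseq: "sorted_wrt P xs \<longleftrightarrow> (\<forall>a b. subseq [a, b] xs \<longrightarrow> P a b)"
proof (induction xs)
  case (Cons x xs)
  have "b \<in> set xs" if "subseq [a, b] xs" for a b
    using that subseq_Cons'[of a "[b]" xs] by (simp add: subseq_singleton_left)
  thus ?case using Cons by (auto simp: subseq_singleton_left)
qed simp

lemma avoids213_iff_subseq:
  "avoids213 xs \<longleftrightarrow> \<not> (\<exists>b a c. subseq [b, a, c] xs \<and> a < b \<and> b < c)"
proof (induction xs)
  case (Cons x xs)
  have "subseq [b, a, c] (x # xs) \<longleftrightarrow> b = x \<and> subseq [a, c] xs \<or> subseq [b, a, c] xs" for a b c
    using subseq_Cons'[of b "[a, c]" xs] by (cases "b = x") auto
  thus ?case using Cons by (simp only: avoids213.simps sorted_wrt_iff_subseq) blast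
qed simp

lemma order_isomorphic_Nil: "order_isomorphic ys [] \<longleftrightarrow> ys = []"
  by (auto simp: order_isomorphic_def)

text \<open>
  Peels off one letter of a pattern, so that the simplifier can turn an explicit pattern into a
  conjunction of inequalities.
\<close>

lemma order_isomorphic_Cons:
  "order_isomorphic ys (s # \<sigma>) \<longleftrightarrow> (\<exists>x xs. ys = x # xs \<and>
     list_all2 (\<lambda>a b. (x < a \<longleftrightarrow> s < b) \<and> (a < x \<longleftrightarrow> b < s)) xs \<sigma> \<and> order_isomorphic xs \<sigma>)"
proof (cases ys)
  case (Cons x xs)
  have all_less_Suc: "(\<forall>i<Suc n. P i) \<longleftrightarrow> P 0 \<and> (\<forall>i<n. P (Suc i))" for n P
    by (auto simp: less_Suc_eq_0_disj)
  show ?thesis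
    unfolding Cons order_isomorphic_def list_all2_conv_all_nth
    by (simp add: all_less_Suc cong: conj_cong) blast
qed (simp add: order_isomorphic_def)

lemmas order_isomorphic_simps = order_isomorphic_Nil order_isomorphic_Cons list_all2_Cons2

lemma contains_pattern_21: "contains_pattern \<pi> [2, 1] \<longleftrightarrow> (\<exists>a b. subseq [a, b] \<pi> \<and> b < a)"
proof -
  have "order_isomorphic ys [2, 1] \<longleftrightarrow> (\<exists>a b. ys = [a, b] \<and> b < a)" for ys
    by (auto simp: order_isomorphic_simps)
  thus ?thesis by (auto simp: contains_pattern_def)
qed

lemma contains_pattern_123:
  "contains_pattern \<pi> [1, 2, 3] \<longleftrightarrow> (\<exists>a b c. subseq [a, b, c] \<pi> \<and> a < b \<and> b < c)"
proof -
  have "order_isomorphic ys [1, 2, 3] \<longleftrightarrow> (\<exists>a b c. ys = [a, b, c] \<and> a < b \<and> b < c)" for ys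
    by (auto simp: order_isomorphic_simps)
  thus ?thesis by (auto simp: contains_pattern_def)
qed

lemma contains_pattern_132:
  "contains_pattern \<pi> [1, 3, 2] \<longleftrightarrow> (\<exists>a b c. subseq [a, b, c] \<pi> \<and> a < c \<and> c < b)"
proof -
  have "order_isomorphic ys [1, 3, 2] \<longleftrightarrow> (\<exists>a b c. ys = [a, b, c] \<and> a < c \<and> c < b)" for ys
    by (auto simp: order_isomorphic_simps)
  thus ?thesis by (auto simp: contains_pattern_def)
qed

text \<open>
  The four patterns are the four ways to place a first letter relative to an occurrence
  \<open>b c d\<close> of 213.
\<close>

lemma contains_star213_iff:
  "contains_star213 \<pi> \<longleftrightarrow> (\<exists>a b c d. subseq [a, b, c, d] \<pi> \<and> c < b \<and> b < d \<and>
     (d < a \<or> b < a \<and> a < d \<or> c < a \<and> a < b \<or> a < c))"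
proof -
  have 1: "order_isomorphic ys [4, 2, 1, 3] \<longleftrightarrow> (\<exists>a b c d. ys = [a, b, c, d] \<and> c < b \<and> b < d \<and> d < a)" for ys
    by (auto simp: order_isomorphic_simps)
  have 2: "order_isomorphic ys [3, 2, 1, 4] \<longleftrightarrow> (\<exists>a b c d. ys = [a, b, c, d] \<and> c < b \<and> b < d \<and> b < a \<and> a < d)" for ys
    by (auto simp: order_isomorphic_simps)
  have 3: "order_isomorphic ys [2, 3, 1, 4] \<longleftrightarrow> (\<exists>a b c d. ys = [a, b, c, d] \<and> c < b \<and> b < d \<and> c < a \<and> a < b)" for ys
    by (auto simp: order_isomorphic_simps)
  have 4: "order_isomorphic ys [1, 3, 2, 4] \<longleftrightarrow> (\<exists>a b c d. ys = [a, b, c, d] \<and> c < b \<and> b < d \<and> a < c)" for ys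
    by (auto simp: order_isomorphic_simps)
  show ?thesis
    unfolding contains_star213_def contains_pattern_def bex_simps 1 2 3 4 by blast
qed

lemma contains_star213_Cons:
  assumes "k \<notin> set \<rho>"
  shows "contains_star213 (k # \<rho>) \<longleftrightarrow> \<not> avoids213 \<rho>"
proof
  assume "contains_star213 (k # \<rho>)"
  then obtain a b c d where s: "subseq [a, b, c, d] (k # \<rho>)" and o: "c < b" "b < d"
    by (auto simp: contains_star213_iff)
  have "subseq [b, c, d] \<rho>"
    using s subseq_Cons'[of a "[b, c, d]" \<rho>] by (auto split: if_splits)
  thus "\<not> avoids213 \<rho>" using o by (auto simp: avoids213_iff_subseq)
next
  assume "\<not> avoids213 \<rho>"
  then obtain b c d where s: "subseq [b, c, d] \<rho>" and o: "c < b" "b < d"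
    by (auto simp: avoids213_iff_subseq)
  have "set [b, c, d] \<subseteq> set \<rho>" using s by (rule set_subseq)
  hence "k \<noteq> b" "k \<noteq> c" "k \<noteq> d" using assms by auto
  hence "d < k \<or> b < k \<and> k < d \<or> c < k \<and> k < b \<or> k < c"
    using o by linarith
  moreover have "subseq [k, b, c, d] (k # \<rho>)" using s by simp
  ultimately show "contains_star213 (k # \<rho>)"
    unfolding contains_star213_iff using o by blast
qed

lemma contains_xi_Cons:
  assumes "distinct (k # \<rho>)"
  shows "contains_xi (k # \<rho>) \<longleftrightarrow> \<not> descents_into k \<rho>"
proof -
  have "descents_into k \<rho> \<longleftrightarrow> (\<forall>i. Suc i < length \<rho> \<longrightarrow> \<rho> ! Suc i < \<rho> ! i \<longrightarrow> \<rho> ! Suc i < k)"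
    by (simp add: successively_conv_nth)
  also have "\<dots> \<longleftrightarrow> \<not> (\<exists>i. Suc i < length \<rho> \<and> \<rho> ! Suc i < \<rho> ! i \<and> k < \<rho> ! Suc i)"
  proof -
    have "\<rho> ! Suc i \<noteq> k" if "Suc i < length \<rho>" for i using assms that by auto
    thus ?thesis by (metis linorder_less_linear less_asym)
  qed
  also have "(\<exists>i. Suc i < length \<rho> \<and> \<rho> ! Suc i < \<rho> ! i \<and> k < \<rho> ! Suc i) \<longleftrightarrow> contains_xi (k # \<rho>)"
  proof
    assume "\<exists>i. Suc i < length \<rho> \<and> \<rho> ! Suc i < \<rho> ! i \<and> k < \<rho> ! Suc i"
    then obtain i where "Suc i < length \<rho>" "\<rho> ! Suc i < \<rho> ! i" "k < \<rho> ! Suc i" by blast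
    thus "contains_xi (k # \<rho>)"
      unfolding contains_xi_def by (intro exI[of _ "Suc (Suc i)"]) auto
  next
    assume "contains_xi (k # \<rho>)"
    then obtain i where i: "i \<ge> 2" "i + 1 \<le> length (k # \<rho>)" "(k # \<rho>) ! 0 < (k # \<rho>) ! i"
      "(k # \<rho>) ! i < (k # \<rho>) ! (i - 1)"
      unfolding contains_xi_def by blast
    hence "i = Suc (Suc (i - 2))" by simp
    then obtain i' where "i = Suc (Suc i')" by blast
    thus "\<exists>i. Suc i < length \<rho> \<and> \<rho> ! Suc i < \<rho> ! i \<and> k < \<rho> ! Suc i"
      using i by (intro exI[of _ i']) auto
  qed
  finally show ?thesis by simp
qed

section \<open>The output of a stack\<close>

lemma push_mset:
  "mset (snd (push \<Sigma> x (s, out)) @ fst (push \<Sigma> x (s, out))) = add_mset x (mset (out @ s))"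
  by (induction \<Sigma> x "(s, out)" arbitrary: s out rule: push.induct) auto

lemma fold_push_mset:
  "mset (snd (fold (push \<Sigma>) xs (s, out)) @ fst (fold (push \<Sigma>) xs (s, out))) = mset (out @ s @ xs)"
proof (induction xs arbitrary: s out)
  case (Cons x xs)
  obtain s' out' where p: "push \<Sigma> x (s, out) = (s', out')" by fastforce
  show ?case using push_mset[of \<Sigma> x s out] Cons[of s' out'] by (simp add: p)
qed simp

lemma stack_output_eq:
  "stack_output \<Sigma> \<pi> = snd (fold (push \<Sigma>) \<pi> ([], [])) @ fst (fold (push \<Sigma>) \<pi> ([], []))"
  by (simp add: stack_output_def split: prod.split)

lemma mset_stack_output: "mset (stack_output \<Sigma> \<pi>) = mset \<pi>"
  using fold_push_mset[of \<Sigma> \<pi> "[]" "[]"] by (simp add: stack_output_eq)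

text \<open>
  Letters above each other in the stack can only be output from top to bottom.  So output followed by
  stack content, as a word, never loses a subsequence: a wrong order, once present, is permanent.
\<close>

lemma push_subseq:
  "subseq (out @ s) (snd (push \<Sigma> x (s, out)) @ fst (push \<Sigma> x (s, out)))"
proof (induction \<Sigma> x "(s, out)" arbitrary: s out rule: push.induct)
  case (2 \<Sigma> x y s out)
  show ?case
  proof (cases "\<exists>\<sigma>\<in>\<Sigma>. contains_pattern (x # y # s) \<sigma>")
    case True thus ?thesis using 2[OF True] by simp
  next
    case False thus ?thesis by (auto intro!: list_emb_append_mono)
  qed
qed (auto intro!: list_emb_append_mono)

lemma fold_push_subseq:
  "subseq (out @ s) (snd (fold (push \<Sigma>) xs (s, out)) @ fst (fold (push \<Sigma>) xs (s, out)))"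
proof (induction xs arbitrary: s out)
  case (Cons x xs)
  obtain s' out' where p: "push \<Sigma> x (s, out) = (s', out')" by fastforce
  show ?case
    using push_subseq[of out s \<Sigma> x] Cons[of out' s'] by (auto simp: p intro: subseq_order.trans)
qed simp

lemma push_out: "\<exists>zs. snd (push \<Sigma> x (s, out)) = out @ zs"
  by (induction \<Sigma> x "(s, out)" arbitrary: s out rule: push.induct) auto

lemma fold_push_out: "\<exists>zs. snd (fold (push \<Sigma>) xs (s, out)) = out @ zs"
proof (induction xs arbitrary: s out)
  case (Cons x xs)
  obtain s' out' where p: "push \<Sigma> x (s, out) = (s', out')" by fastforce
  show ?case
    using push_out[of \<Sigma> x s out] Cons[of s' out'] by (auto simp: p)
qed simp

text \<open>
  Popping stops at the latest when only \<open>t\<close> is left, because pushing onto \<open>t\<close> is harmless.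
\<close>

lemma push_keeps_bottom:
  assumes "t \<noteq> []" "\<forall>\<sigma>\<in>\<Sigma>. \<not> contains_pattern (x # t) \<sigma>"
  shows "\<exists>w'. fst (push \<Sigma> x (w @ t, out)) = w' @ t"
proof (induction w arbitrary: out)
  case Nil
  obtain y t' where "t = y # t'" using assms(1) by (cases t) auto
  thus ?case using assms(2) by simp
next
  case (Cons y w)
  have "\<exists>w'. x # y # w @ t = w' @ t" by (rule exI[of _ "x # y # w"]) simp
  thus ?case using Cons by simp
qed

lemma fold_push_keeps_bottom:
  assumes "t \<noteq> []" "\<forall>x\<in>set xs. \<forall>\<sigma>\<in>\<Sigma>. \<not> contains_pattern (x # t) \<sigma>"
  shows "\<exists>w'. fst (fold (push \<Sigma>) xs (w @ t, out)) = w' @ t"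
  using assms(2)
proof (induction xs arbitrary: w out)
  case (Cons x xs)
  obtain w' where "fst (push \<Sigma> x (w @ t, out)) = w' @ t"
    using push_keeps_bottom[OF assms(1)] Cons.prems by fastforce
  then obtain out' where "push \<Sigma> x (w @ t, out) = (w' @ t, out')"
    by (metis prod.collapse)
  thus ?case using Cons by simp
qed simp

section \<open>Sorting with the 21-stack\<close>

lemma push_21_sorted:
  assumes "sorted_wrt (<) s" "x \<notin> set s"
  shows "push {[2, 1]} x (s, out) = (x # dropWhile (\<lambda>y. y < x) s, out @ takeWhile (\<lambda>y. y < x) s)"
  using assms
proof (induction s arbitrary: out)
  case (Cons y s)
  have "contains_pattern (x # y # s) [2, 1] \<longleftrightarrow> \<not> sorted_wrt (\<le>) (x # y # s)"
    unfolding contains_pattern_21 sorted_wrt_iff_subseq by (auto simp: not_le)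
  also have "\<dots> \<longleftrightarrow> y < x"
    using Cons.prems by (auto intro: less_imp_le order.trans sorted_wrt_mono_rel[of _ "(<)"])
  finally show ?case using Cons by auto
qed simp

lemma fold_push_21_decreasing:
  "sorted_wrt (>) P \<Longrightarrow> fold (push {[2, 1]}) P ([], []) = (rev P, [])"
proof (induction P rule: rev_induct)
  case (snoc x P)
  have "takeWhile (\<lambda>y. y < x) (rev P) = [] \<and> dropWhile (\<lambda>y. y < x) (rev P) = rev P"
    using snoc.prems by (cases P rule: rev_cases) (auto simp: sorted_wrt_append)
  moreover have "push {[2, 1]} x (rev P, []) =
      (x # dropWhile (\<lambda>y. y < x) (rev P), [] @ takeWhile (\<lambda>y. y < x) (rev P))"
    using snoc.prems by (intro push_21_sorted) (auto simp: sorted_wrt_append sorted_wrt_rev)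
  ultimately show ?case using snoc by (simp add: sorted_wrt_append)
qed simp

text \<open>
  At the first ascent the top of the stack is smaller than the incoming letter and is popped.
\<close>

lemma fold_push_21_not_decreasing:
  assumes "distinct P" "\<not> sorted_wrt (>) P"
  shows "snd (fold (push {[2, 1]}) P ([], [])) \<noteq> []"
  using assms
proof (induction P rule: rev_induct)
  case (snoc x P)
  obtain s out where so: "fold (push {[2, 1]}) P ([], []) = (s, out)" by fastforce
  show ?case
  proof (cases "sorted_wrt (>) P")
    case True
    hence "fold (push {[2, 1]}) P ([], []) = (rev P, [])" by (rule fold_push_21_decreasing)
    moreover have "push {[2, 1]} x (rev P, []) =
      (x # dropWhile (\<lambda>y. y < x) (rev P), [] @ takeWhile (\<lambda>y. y < x) (rev P))"
      using snoc.prems True by (intro push_21_sorted) (auto simp: sorted_wrt_rev)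
    moreover have "takeWhile (\<lambda>y. y < x) (rev P) \<noteq> []"
    proof
      assume t: "takeWhile (\<lambda>y. y < x) (rev P) = []"
      have "\<forall>p\<in>set P. x < p"
      proof (cases P rule: rev_cases)
        case (snoc Q l)
        thus ?thesis using t True snoc.prems by (auto simp: sorted_wrt_append split: if_splits)
      qed simp
      thus False using snoc.prems True by (simp add: sorted_wrt_append)
    qed
    ultimately show ?thesis by simp
  next
    case False
    hence "out \<noteq> []" using snoc so by auto
    thus ?thesis using push_out[of "{[2, 1]}" x s out] so by auto
  qed
qed simp

text \<open>
  If \<open>P\<close> is not decreasing, some entry of \<open>P\<close> is output before \<open>v\<close> enters the stack, although it is
  larger than \<open>v\<close>.  For \<open>v = 1\<close> this is the part of Knuth's theorem on the pattern 231 that is needed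
  here.
\<close>

lemma stack_output_21_imp_decreasing:
  assumes "distinct (P @ v # Q)" "\<forall>x\<in>set P. v < x" "sorted (stack_output {[2, 1]} (P @ v # Q))"
  shows "sorted_wrt (>) P"
proof (rule ccontr)
  assume "\<not> sorted_wrt (>) P"
  with assms(1) obtain s y out where so: "fold (push {[2, 1]}) P ([], []) = (s, y # out)"
    using fold_push_21_not_decreasing[of P]
    by (metis distinct_append list.exhaust prod.collapse snd_conv)
  have "y \<in> set P" using mset_eq_setD[OF fold_push_mset[of "{[2, 1]}" P "[]" "[]"]] so
    by (auto simp del: One_nat_def)
  moreover obtain zs where zs: "stack_output {[2, 1]} (P @ v # Q) = y # zs"
    using fold_push_out[of "{[2, 1]}" "v # Q" s "y # out"] by (auto simp: stack_output_eq so simp del: One_nat_def)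
  have "v \<in> set (y # zs)"
    using mset_eq_setD[OF mset_stack_output[of "{[2, 1]}" "P @ v # Q"]] zs by simp
  hence "y \<le> v" using assms(3) zs by (auto simp del: One_nat_def)
  ultimately show False using assms(2) by (auto simp: not_le[symmetric])
qed

text \<open>
  The whole of \<open>P\<close> is stacked, with its smallest entry on top, and \<open>k\<close> is then inserted in its place.
\<close>

lemma stack_output_21_decreasing:
  assumes "sorted_wrt (>) P" "k \<notin> set P"
  shows "sorted_wrt (<) (stack_output {[2, 1]} (P @ [k]))"
proof -
  have s: "sorted_wrt (<) (rev P)" using assms(1) by (simp add: sorted_wrt_rev)
  have "stack_output {[2, 1]} (P @ [k])
      = takeWhile (\<lambda>y. y < k) (rev P) @ k # dropWhile (\<lambda>y. y < k) (rev P)"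
    using push_21_sorted[OF s] assms(2)
    by (simp add: stack_output_eq fold_push_21_decreasing[OF assms(1)] del: One_nat_def)
  also have "sorted_wrt (<) \<dots>"
  proof -
    have "sorted_wrt (<) (takeWhile (\<lambda>y. y < k) s @ k # dropWhile (\<lambda>y. y < k) s)"
      if "sorted_wrt (<) s" "k \<notin> set s" for s
      using that by (induction s) (auto dest: set_takeWhileD set_dropWhileD)
    thus ?thesis using s assms(2) by simp
  qed
  finally show ?thesis .
qed

section \<open>The (123,132)-stack above its bottom entry\<close>

text \<open>
  From here on a push is unfolded only after its test for patterns has been simplified.
\<close>

declare push.simps(2) [simp del]

text \<open>
  Named after what the two patterns have in common.  As a constant, the set also protects its numerals from being
  rewritten.
\<close>

definition min_first :: "nat list set" where
  "min_first = {[1, 2, 3], [1, 3, 2]}"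

text \<open>
  A word with distinct letters contains 123 or 132 iff some letter has two larger letters to its
  right (\<open>contains_min_first\<close>).  For a stack, read from top to bottom, these lie below it.
\<close>

definition blocked :: "nat list \<Rightarrow> bool" where
  "blocked s \<longleftrightarrow> (\<exists>a b c. subseq [a, b, c] s \<and> a < b \<and> a < c)"

lemma blocked_Nil [simp]: "\<not> blocked []"
  by (simp add: blocked_def)

lemma blocked_Cons:
  "blocked (x # s) \<longleftrightarrow> (\<exists>b c. subseq [b, c] s \<and> x < b \<and> x < c) \<or> blocked s"
proof -
  have "subseq [a, b, c] (x # s) \<longleftrightarrow> a = x \<and> subseq [b, c] s \<or> subseq [a, b, c] s" for a b c
    using subseq_Cons'[of a "[b, c]" s] by (cases "a = x") auto
  thus ?thesis by (simp only: blocked_def) blast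
qed

lemma contains_min_first:
  assumes "distinct s"
  shows "(\<exists>\<sigma>\<in>min_first. contains_pattern s \<sigma>) \<longleftrightarrow> blocked s"
proof -
  have "b \<noteq> c" if "subseq [a, b, c] s" for a b c
  proof -
    have "sorted_wrt (\<noteq>) s" using assms by (induction s) auto
    thus ?thesis using subseq_Cons'[OF that] by (auto simp: sorted_wrt_iff_subseq)
  qed
  hence "(\<exists>a b c. subseq [a, b, c] s \<and> a < b \<and> a < c) \<longleftrightarrow>
      (\<exists>a b c. subseq [a, b, c] s \<and> a < b \<and> b < c) \<or> (\<exists>a b c. subseq [a, b, c] s \<and> a < c \<and> c < b)"
    by (meson less_trans linorder_neqE_nat)
  thus ?thesis
    unfolding min_first_def bex_simps contains_pattern_123 contains_pattern_132 blocked_def by blast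
qed

lemma push_min_first:
  assumes "distinct (x # y # s)"
  shows "push min_first x (y # s, out) =
    (if blocked (x # y # s) then push min_first x (s, out @ [y]) else (x # y # s, out))"
  by (simp only: push.simps contains_min_first[OF assms])

lemma subseq_pair_snoc: "subseq [b, c] (w @ [k]) \<Longrightarrow> b \<in> set w"
  by (induction w) (auto split: if_splits)

text \<open>
  Inside \<open>w\<close> nothing larger lies further down, so that only the bottom \<open>k\<close> can exceed an entry.
\<close>

lemma not_blocked_decreasing: "sorted_wrt (>) w \<Longrightarrow> \<not> blocked (w @ [k])"
proof (induction w)
  case (Cons x w)
  thus ?case by (auto simp: blocked_Cons dest!: subseq_pair_snoc)
qed (auto simp: blocked_Cons)

lemma blocked_by_bottom: "x < y \<Longrightarrow> x < k \<Longrightarrow> blocked (x # y # u @ [k])"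
  unfolding blocked_Cons by (intro disjI1 exI[of _ y] exI[of _ k]) (simp add: subseq_singleton_left)

lemma not_contains_min_first_pair:
  "x \<noteq> k \<Longrightarrow> \<forall>\<sigma>\<in>min_first. \<not> contains_pattern [x, k] \<sigma>"
  using contains_min_first[of "[x, k]"] by (auto simp: blocked_Cons split: if_splits)

text \<open>
  Every entry of \<open>u\<close> together with the bottom \<open>k\<close> forms a pattern with \<open>x\<close>.
\<close>

lemma push_pops_all:
  assumes "distinct (x # u @ [k])" "\<forall>y\<in>set u. x < y" "x < k"
  shows "push min_first x (u @ [k], out) = ([x, k], out @ u)"
  using assms
proof (induction u arbitrary: out)
  case Nil
  thus ?case by (simp add: push_min_first blocked_Cons)
next
  case (Cons y u)
  thus ?case by (simp add: push_min_first blocked_by_bottom)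
qed

text \<open>
  For \<open>x < k\<close>, the bottom \<open>k\<close> is one larger entry, so no further one is tolerated.  For \<open>x\<close> larger than all
  of \<open>u\<close>, nothing is popped.  In either case the result is that of an ordinary stack whose content
  increases towards the top.
\<close>

lemma push_decreasing:
  assumes "distinct (x # u @ [k])" "sorted_wrt (>) u" "x < k \<or> (\<forall>y\<in>set u. y < x)"
  shows "push min_first x (u @ [k], out) =
    (x # dropWhile (\<lambda>y. x < y) u @ [k], out @ takeWhile (\<lambda>y. x < y) u)"
  using assms
proof (induction u arbitrary: out)
  case Nil
  thus ?case by (simp add: push_min_first blocked_Cons)
next
  case (Cons y u)
  show ?case
  proof (cases "x < y")
    case True
    with Cons.prems have "x < k" by auto
    with True Cons show ?thesis by (simp add: push_min_first blocked_by_bottom)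
  next
    case False
    with Cons.prems have "sorted_wrt (>) (x # y # u)" by auto
    from not_blocked_decreasing[OF this, of k] show ?thesis
      using False Cons.prems by (simp add: push_min_first)
  qed
qed

text \<open>
  Here the bottom \<open>k\<close> does not count, so popping stops as soon as a single larger entry is left, and
  that one ends up below \<open>x\<close>.
\<close>

lemma push_below_larger:
  assumes "distinct (x # u @ [k])" "sorted_wrt (>) u" "k < x" "\<exists>y\<in>set u. x < y"
  shows "\<exists>u' out'. push min_first x (u @ [k], out) = (x # u' @ [k], out') \<and> (\<exists>y\<in>set u'. x < y)"
  using assms
proof (induction u arbitrary: out)
  case (Cons y u)
  show ?case
  proof (cases "blocked (x # y # u @ [k])")
    case True
    moreover have "\<not> blocked ((y # u) @ [k])"
      using Cons.prems by (intro not_blocked_decreasing)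
    ultimately obtain b c where bc: "subseq [b, c] ((y # u) @ [k])" "x < b" "x < c"
      by (auto simp: blocked_Cons)
    have "c \<in> set (u @ [k])"
      using bc(1) subseq_Cons'[of b "[c]" "u @ [k]"] by (auto simp: subseq_singleton_left split: if_splits)
    hence "c \<in> set u" using bc(3) Cons.prems(3) by auto
    thus ?thesis using True Cons bc(3) by (auto simp: push_min_first)
  next
    case False
    moreover have "x < y" using Cons.prems by auto
    ultimately have "push min_first x ((y # u) @ [k], out) = (x # (y # u) @ [k], out) \<and> (\<exists>z\<in>set (y # u). x < z)"
      using Cons.prems by (simp add: push_min_first)
    thus ?thesis by blast
  qed
qed simp

text \<open>
  The statement is generalised to a run that starts in the middle, with entries \<open>u\<close> above the bottom
  and \<open>out\<close> already output, so that it can be proved by induction.  The second and third conjunct say what the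
  letters to come must respect: they are smaller than what has been output, and they do not complete an
  occurrence of 213 whose first letter is still on the stack.  The top of \<open>u\<close>, which is the letter
  read last, is put in front of \<open>\<rho>\<close> to account for the descent into the first letter of \<open>\<rho>\<close>.
\<close>

lemma fold_push_decreasing_iff:
  assumes "distinct (out @ u @ k # \<rho>)" "sorted_wrt (>) u"
  shows "sorted_wrt (>) (butlast (snd (fold (push min_first) \<rho> (u @ [k], out))
                                @ fst (fold (push min_first) \<rho> (u @ [k], out))))
    \<longleftrightarrow> sorted_wrt (>) (out @ u) \<and> (\<forall>y\<in>set out. \<forall>x\<in>set \<rho>. x < y)
      \<and> (\<forall>y\<in>set u. sorted_wrt (\<lambda>a c. \<not> (a < y \<and> y < c)) \<rho>)
      \<and> avoids213 \<rho> \<and> descents_into k (take 1 u @ \<rho>)"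
  using assms
proof (induction \<rho> arbitrary: u out)
  case Nil
  have "descents_into k (take 1 u)" by (cases u) auto
  thus ?case by (simp add: butlast_append)
next
  case (Cons x \<rho>)
  have d: "distinct (x # u @ [k])" using Cons.prems by auto
  show ?case
  proof (cases "k < x \<and> (\<exists>y\<in>set u. x < y)")
    case True
    obtain u' out' y where p: "push min_first x (u @ [k], out) = (x # u' @ [k], out')"
      and y: "y \<in> set u'" "x < y"
      using push_below_larger[OF d Cons.prems(2)] True by blast
    \<comment> \<open>\<open>x\<close> now lies above the larger \<open>y\<close>, and so precedes it in the output\<close>
    let ?r = "fold (push min_first) \<rho> (x # u' @ [k], out')"
    obtain w' where w: "fst ?r = w' @ [k]"
    proof -
      have "\<forall>z\<in>set \<rho>. \<forall>\<sigma>\<in>min_first. \<not> contains_pattern (z # [k]) \<sigma>"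
        using Cons.prems(1) by (intro ballI not_contains_min_first_pair[rule_format]) auto
      from fold_push_keeps_bottom[OF _ this, of "x # u'" out'] show ?thesis
        using that by auto
    qed
    have "subseq ((out' @ x # u') @ [k]) ((snd ?r @ w') @ [k])"
      using fold_push_subseq[of out' "x # u' @ [k]" min_first \<rho>] w by simp
    hence "subseq (out' @ x # u') (snd ?r @ w')"
      by (simp only: subseq_append)
    moreover have "subseq [x, y] (out' @ x # u')"
      using y by (auto simp: subseq_singleton_left intro: subseq_drop_many)
    ultimately have xy: "subseq [x, y] (snd ?r @ w')"
      by (rule subseq_order.trans[rotated])
    have "butlast (snd ?r @ fst ?r) = snd ?r @ w'" by (simp add: w butlast_append)
    moreover have "\<not> sorted_wrt (>) (snd ?r @ w')"
      using xy y(2) less_asym unfolding sorted_wrt_iff_subseq by blast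
    ultimately have "\<not> sorted_wrt (>) (butlast (snd ?r @ fst ?r))" by simp
    moreover have "\<not> descents_into k (take 1 u @ x # \<rho>)"
    proof (cases u)
      case (Cons z zs)
      have "x < z" using True Cons.prems(2) by (auto simp: Cons)
      thus ?thesis using True by (simp add: Cons)
    qed (use True in simp)
    ultimately show ?thesis by (simp add: p)
  next
    case False
    hence c: "x < k \<or> (\<forall>y\<in>set u. y < x)"
      using d by auto (metis linorder_less_linear)
    \<comment> \<open>the entries that \<open>x\<close> pops, and those that stay below it\<close>
    define tw dw where "tw = takeWhile (\<lambda>y. x < y) u" and "dw = dropWhile (\<lambda>y. x < y) u"
    have u: "u = tw @ dw" by (simp add: tw_def dw_def)
    have tw: "\<forall>y\<in>set tw. x < y" by (auto simp: tw_def dest: set_takeWhileD)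
    have dw: "\<forall>y\<in>set dw. y < x"
    proof -
      have "\<forall>y\<in>set dw. y < x" if "sorted_wrt (>) u" "x \<notin> set u"
        using that unfolding dw_def by (induction u) auto
      thus ?thesis using Cons.prems(2) d by simp
    qed
    have s: "sorted_wrt (>) tw" "sorted_wrt (>) dw"
      using Cons.prems(2) by (auto simp: u sorted_wrt_append)
    have p: "push min_first x (u @ [k], out) = ((x # dw) @ [k], out @ tw)"
      using push_decreasing[OF d Cons.prems(2) c] by (simp add: tw_def dw_def)
    have IH: "sorted_wrt (>) (butlast (snd (fold (push min_first) \<rho> ((x # dw) @ [k], out @ tw))
                                @ fst (fold (push min_first) \<rho> ((x # dw) @ [k], out @ tw))))
      \<longleftrightarrow> sorted_wrt (>) ((out @ tw) @ x # dw) \<and> (\<forall>y\<in>set (out @ tw). \<forall>z\<in>set \<rho>. z < y)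
      \<and> (\<forall>y\<in>set (x # dw). sorted_wrt (\<lambda>a c. \<not> (a < y \<and> y < c)) \<rho>)
      \<and> avoids213 \<rho> \<and> descents_into k (take 1 (x # dw) @ \<rho>)"
      by (rule Cons.IH[where u = "x # dw" and out = "out @ tw"])
         (use Cons.prems u dw s in auto)
    have 1: "sorted_wrt (>) ((out @ tw) @ x # dw) \<longleftrightarrow> sorted_wrt (>) (out @ u) \<and> (\<forall>y\<in>set out. x < y)"
      using tw dw by (auto simp: u sorted_wrt_append dest: less_trans)
    \<comment> \<open>a popped entry has just seen the smaller \<open>x\<close>, so a larger letter would complete 213\<close>
    have 2: "sorted_wrt (\<lambda>a c. \<not> (a < y \<and> y < c)) (x # \<rho>) \<longleftrightarrow> (\<forall>z\<in>set \<rho>. z < y)" if "y \<in> set tw" for y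
    proof -
      have y: "y \<notin> set \<rho>" "x < y" using that tw Cons.prems(1) by (auto simp: u)
      hence "\<not> y < z \<longleftrightarrow> z < y" if "z \<in> set \<rho>" for z
        using that by (cases z y rule: linorder_cases) auto
      moreover have "sorted_wrt (\<lambda>a c. \<not> (a < y \<and> y < c)) \<rho>" if "\<forall>z\<in>set \<rho>. z < y"
        by (rule sorted_wrt_if_all) (use that less_asym in blast)
      ultimately show ?thesis using y(2) by auto
    qed
    have 3: "sorted_wrt (\<lambda>a c. \<not> (a < y \<and> y < c)) (x # \<rho>) \<longleftrightarrow> sorted_wrt (\<lambda>a c. \<not> (a < y \<and> y < c)) \<rho>"
      if "y \<in> set dw" for y
      using that dw by (auto dest: less_asym)
    have 4: "descents_into k (take 1 u @ x # \<rho>) \<longleftrightarrow> descents_into k (x # \<rho>)"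
      using c by (cases u) auto
    have "set u = set tw \<union> set dw" by (simp add: u)
    thus ?thesis
      unfolding fold.simps comp_apply p IH 1 4
      using 2 3 by auto
  qed
qed

section \<open>Sortable permutations\<close>

text \<open>
  The output of the first stack is \<open>Pk\<close>.  The second stack succeeds iff \<open>P\<close> is decreasing, and
  \<open>fold_push_decreasing_iff\<close>, for a run that starts with only \<open>k\<close> on the stack, tells when this is the case.
\<close>

lemma sortable_iff:
  assumes "distinct (k # \<rho>)" "set (k # \<rho>) = {1..n}"
  shows "sortable {[1, 2, 3], [1, 3, 2]} (k # \<rho>) \<longleftrightarrow> avoids213 \<rho> \<and> descents_into k \<rho>"
proof -
  define \<omega> where "\<omega> = stack_output min_first (k # \<rho>)"
  define r where "r = fold (push min_first) \<rho> ([k], [])"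
  have \<omega>r: "\<omega> = snd r @ fst r"
    by (simp add: \<omega>_def r_def stack_output_eq)
  have pair: "\<forall>z\<in>set \<rho>. \<forall>\<sigma>\<in>min_first. \<not> contains_pattern (z # [k]) \<sigma>"
    using assms(1) by (intro ballI not_contains_min_first_pair[rule_format]) auto
  obtain w where w: "fst r = w @ [k]"
    using fold_push_keeps_bottom[OF _ pair, of "[]" "[]"] by (auto simp: r_def)
  define P where "P = snd r @ w"
  have \<omega>P: "\<omega> = P @ [k]" by (simp add: P_def \<omega>r w)
  have dec: "sorted_wrt (>) P \<longleftrightarrow> avoids213 \<rho> \<and> descents_into k \<rho>"
  proof -
    have "butlast \<omega> = P" by (simp add: \<omega>P)
    thus ?thesis
      using fold_push_decreasing_iff[of "[]" "[]" k \<rho>] assms(1)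
      by (simp add: \<omega>r r_def)
  qed
  have m: "mset (P @ [k]) = mset (k # \<rho>)"
    using mset_stack_output[of min_first "k # \<rho>"] by (simp add: \<omega>_def[symmetric] \<omega>P)
  have dP: "distinct (P @ [k])" using m assms(1) by (metis mset_eq_imp_distinct_iff)
  have setP: "set (P @ [k]) = {1..n}" using mset_eq_setD[OF m] assms(2) by simp
  have len: "length (k # \<rho>) = n" using distinct_card[OF assms(1)] assms(2) by simp
  have iff: "sortable {[1, 2, 3], [1, 3, 2]} (k # \<rho>) \<longleftrightarrow> stack_output {[2, 1]} (P @ [k]) = [1..<n + 1]"
    unfolding sortable_def min_first_def[symmetric] \<omega>_def[symmetric] \<omega>P len by (rule refl)
  have "sorted_wrt (>) P" if sorted: "stack_output {[2, 1]} (P @ [k]) = [1..<n + 1]"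
  proof (cases "k = 1")
    case True
    have "\<forall>x\<in>set P. k < x"
    proof
      fix x assume x: "x \<in> set P"
      hence "x \<noteq> k" using dP by auto
      moreover have "1 \<le> x" using x setP by auto
      ultimately show "k < x" using True by simp
    qed
    thus ?thesis
      using stack_output_21_imp_decreasing[of P k "[]"] sorted dP by (simp del: One_nat_def)
  next
    case False
    have "1 \<in> set (k # \<rho>)"
      using assms(2) by (metis atLeastAtMost_iff le_refl list.set_intros(1) order_trans)
    hence "1 \<in> set \<rho>" using False by simp
    then obtain \<alpha> \<beta> where \<rho>: "\<rho> = \<alpha> @ 1 # \<beta>" by (auto simp: in_set_conv_decomp)
    have pos: "1 < x" if "x \<in> set \<alpha> \<union> set \<beta> \<union> {k}" for x
    proof -
      have "x \<in> set (k # \<rho>)" "x \<noteq> 1" using that assms(1) False by (auto simp: \<rho>)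
      thus ?thesis using assms(2) by (metis One_nat_def atLeastAtMost_iff le_neq_implies_less)
    qed
    obtain u out where uo: "fold (push min_first) \<alpha> ([k], []) = (u @ [k], out)"
      using fold_push_keeps_bottom[of "[k]" \<alpha> min_first "[]" "[]"] pair
      by (auto simp: \<rho>) (metis prod.collapse)
    have mu: "mset (out @ u @ [k]) = mset (k # \<alpha>)"
      using fold_push_mset[of min_first \<alpha> "[k]" "[]"] by (simp add: uo)
    have "set u \<subseteq> set \<alpha>" "distinct (1 # u @ [k])"
    proof -
      have "distinct (k # \<alpha>)" using assms(1) by (simp add: \<rho>)
      hence d: "distinct (out @ u @ [k])" using mu by (metis mset_eq_imp_distinct_iff)
      moreover have s: "set (out @ u @ [k]) = insert k (set \<alpha>)" using mset_eq_setD[OF mu] by simp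
      ultimately show "set u \<subseteq> set \<alpha>" by auto
      thus "distinct (1 # u @ [k])" using d pos[of 1] by auto
    qed
    \<comment> \<open>the letter 1 clears the stack down to \<open>k\<close>, and then sits on \<open>k\<close> until the end\<close>
    hence "push min_first 1 (u @ [k], out) = ([1, k], out @ u)"
      by (intro push_pops_all) (use pos in auto)
    hence r1: "r = fold (push min_first) \<beta> ([] @ [1, k], out @ u)"
      by (simp add: r_def \<rho> uo)
    have "\<not> (\<exists>\<sigma>\<in>min_first. contains_pattern (x # [1, k]) \<sigma>)" if x: "x \<in> set \<beta>" for x
    proof -
      have "x \<noteq> k" "1 < x" "1 < k" using pos x assms(1) by (auto simp: \<rho>)
      thus ?thesis
        by (subst contains_min_first)
           (auto simp: blocked_Cons subseq_singleton_left split: if_splits)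
    qed
    then obtain w' where "fst r = w' @ [1, k]"
      using fold_push_keeps_bottom[of "[1, k]" \<beta> min_first "[]" "out @ u"] unfolding r1 by blast
    hence "w = w' @ [1]" using w by simp
    hence P: "P = (snd r @ w') @ [1]" by (simp add: P_def)
    have gt: "\<forall>x\<in>set (snd r @ w'). 1 < x"
    proof
      fix x assume x: "x \<in> set (snd r @ w')"
      hence "x \<in> set (P @ [k])" "x \<noteq> 1" using dP by (auto simp: P)
      thus "1 < x" using setP by (metis One_nat_def atLeastAtMost_iff le_neq_implies_less)
    qed
    have "sorted_wrt (>) (snd r @ w')"
      by (rule stack_output_21_imp_decreasing[of _ 1 "[k]"])
         (use gt dP sorted in \<open>simp_all add: P del: One_nat_def\<close>)
    thus ?thesis unfolding P sorted_wrt_append[of _ "snd r @ w'"] using gt by simp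
  qed
  moreover have "stack_output {[2, 1]} (P @ [k]) = [1..<n + 1]" if "sorted_wrt (>) P"
  proof (rule strict_sorted_equal)
    show "sorted_wrt (<) (stack_output {[2, 1]} (P @ [k]))"
      using that dP by (intro stack_output_21_decreasing) auto
    show "set (stack_output {[2, 1]} (P @ [k])) = set [1..<n + 1]"
      using mset_eq_setD[OF mset_stack_output[of "{[2, 1]}" "P @ [k]"]] setP by auto
  qed (rule sorted_wrt_upt)
  ultimately show ?thesis using iff dec by blast
qed

section \<open>The Catalan convolution\<close>

lemma catalan_0: "catalan 0 = 1"
  by (simp add: catalan_def)

lemma catalan_Suc: "(real n + 2) * catalan (Suc n) = (4 * real n + 2) * catalan n"
proof -
  have step: "(real n + 1) * real ((2 * Suc n) choose Suc n) = (4 * real n + 2) * real ((2 * n) choose n)"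
  proof -
    have a: "real ((2 * n) choose n) * (fact n * fact n) = fact (2 * n)"
      by (subst binomial_fact) auto
    have "real ((2 * Suc n) choose Suc n) * (fact (Suc n) * fact (Suc n)) = fact (2 * Suc n)"
      by (subst binomial_fact) auto
    also have "fact (2 * Suc n) = (2 * real n + 2) * ((2 * real n + 1) * fact (2 * n))"
      by (simp only: mult_Suc_right add_Suc_right add_2_eq_Suc fact_Suc of_nat_Suc) (simp add: ac_simps)
    also have "fact (Suc n) = (real n + 1) * fact n"
      by (simp only: fact_Suc of_nat_Suc) simp
    finally have "(real n + 1) * real ((2 * Suc n) choose Suc n) * ((real n + 1) * (fact n * fact n))
        = (4 * real n + 2) * real ((2 * n) choose n) * ((real n + 1) * (fact n * fact n))"
      unfolding a[symmetric] by (simp only: algebra_simps)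
    thus ?thesis by simp
  qed
  have "(real n + 2) * catalan (Suc n) = real ((2 * Suc n) choose Suc n)"
    by (simp add: catalan_def field_simps)
  also have "\<dots> = (4 * real n + 2) * (1 / (real n + 1) * real ((2 * n) choose n))"
    using step by (simp only: times_divide_eq_right times_divide_eq_left mult_1_left) (simp only: field_simps)
  finally show ?thesis by (simp only: catalan_def)
qed

text \<open>
  The generating function satisfies \<open>C = 1 + XC\<^sup>2\<close>.  Completing the square, \<open>S = 1 - 2XC\<close> is a
  square root of \<open>1 - 4X\<close>, and differentiating \<open>S\<^sup>2\<close> gives the differential equation
  \<open>(1 - 4X) S' = -2S\<close>.  Its coefficients are the two-term recursion \<open>catalan_Suc\<close>.
\<close>

lemma catalan_unique:
  fixes c :: "nat \<Rightarrow> real"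
  assumes c0: "c 0 = 1"
    and conv: "\<And>n. c (Suc n) = (\<Sum>i\<le>n. c i * c (n - i))"
  shows "c n = catalan n"
proof -
  define C where "C = Abs_fps c"
  have fixpoint: "C = 1 + fps_X * C\<^sup>2"
  proof (rule fps_ext)
    have "fps_nth (C * C) m = (\<Sum>i\<le>m. c i * c (m - i))" for m
      by (simp add: C_def fps_mult_nth atLeast0AtMost)
    thus "fps_nth C n = fps_nth (1 + fps_X * C\<^sup>2) n" for n
      by (cases n) (simp_all add: C_def c0 conv power2_eq_square)
  qed
  define S where "S = 1 - fps_const 2 * (fps_X * C)"
  have sq: "S\<^sup>2 = 1 - 4 * fps_X"
  proof -
    have "S\<^sup>2 = 1 - 4 * fps_X * C + 4 * fps_X * (fps_X * C\<^sup>2)"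
      by (simp add: S_def power2_eq_square numeral_fps_const[symmetric] algebra_simps)
    also have "fps_X * C\<^sup>2 = C - 1"
      using fixpoint by (simp add: algebra_simps)
    finally show ?thesis by (simp add: algebra_simps)
  qed
  \<comment> \<open>differentiate, and multiply by \<open>S\<close> to replace \<open>S\<^sup>2\<close> by \<open>1 - 4X\<close> on the left\<close>
  have "fps_deriv (S\<^sup>2) = - 4"
    unfolding sq by simp
  hence "2 * S * fps_deriv S = - 4"
    by (simp add: power2_eq_square algebra_simps)
  hence "S * (2 * S * fps_deriv S) = S * (- 4)"
    by (rule arg_cong)
  hence "2 * ((S\<^sup>2 * fps_deriv S)) = 2 * (- 2 * S)"
    by (simp add: power2_eq_square algebra_simps)
  hence "S\<^sup>2 * fps_deriv S = - 2 * S"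
    by (rule mult_left_cancel[THEN iffD1, rotated]) simp
  hence ode: "(1 - 4 * fps_X) * fps_deriv S = - 2 * S"
    by (simp only: sq)
  have s: "fps_nth S (Suc n) = - 2 * c n" for n
    by (simp add: S_def C_def)
  have rec: "(real n + 2) * c (Suc n) = (4 * real n + 2) * c n" for n
  proof -
    have "fps_deriv S - fps_const 4 * (fps_X * fps_deriv S) = fps_const (- 2) * S"
      using ode by (simp add: left_diff_distrib mult.assoc numeral_fps_const fps_const_neg[symmetric] del: fps_const_neg)
    hence "fps_nth (fps_deriv S - fps_const 4 * (fps_X * fps_deriv S)) (Suc n)
        = fps_nth (fps_const (- 2) * S) (Suc n)"
      by simp
    thus ?thesis
      by (simp only: fps_sub_nth fps_mult_left_const_nth fps_X_mult_nth fps_deriv_nth s)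
         (simp add: s algebra_simps)
  qed
  show ?thesis
  proof (induction n)
    case 0 thus ?case by (simp add: c0 catalan_0)
  next
    case (Suc n)
    have "(real n + 2) * c (Suc n) = (real n + 2) * catalan (Suc n)"
      using rec[of n] catalan_Suc[of n] Suc by simp
    moreover have "real n + 2 \<noteq> 0" by simp
    ultimately show ?case by (meson mult_left_cancel)
  qed
qed

section \<open>Ballot numbers\<close>

text \<open>
  The rows are 1; 1, 1; 1, 2, 2; 1, 3, 5, 5; and so on: Catalan's triangle.  The recursion is the one that
  the decomposition of a tail at its minimum produces, where \<open>b\<close> is the length of the part after
  the minimum: the \<open>j - 1\<close> remaining entries below \<open>k\<close> fill that part first, and the truncated difference
  \<open>j - 1 - b\<close> is what is left of them for the part before the minimum.
\<close>

fun ballot :: "nat \<Rightarrow> nat \<Rightarrow> nat" where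
  "ballot m j =
     (if j = 0 then 1 else \<Sum>b<m. ballot (m - 1 - b) (j - 1 - b) * ballot b (min b (j - 1)))"

declare ballot.simps [simp del]

lemma ballot_0 [simp]: "ballot m 0 = 1"
  by (subst ballot.simps) simp

lemma ballot_Suc:
  "ballot m (Suc i) = (\<Sum>b<m. ballot (m - 1 - b) (i - b) * ballot b (min b i))"
  by (subst ballot.simps) simp

lemma ballot_diagonal_convolution:
  "ballot (Suc n) (Suc n) = (\<Sum>b\<le>n. ballot b b * ballot (n - b) (n - b))"
  by (simp add: ballot_Suc lessThan_Suc_atMost mult.commute min_absorb1)

lemma ballot_diagonal: "real (ballot n n) = catalan n"
  by (rule catalan_unique[of "\<lambda>n. real (ballot n n)"])
     (simp_all add: ballot_diagonal_convolution)

text \<open>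
  Sum the recursion over \<open>j = i + 1\<close> and fix \<open>b\<close>.  The terms with \<open>i < b\<close> add up to row \<open>b\<close> without its
  last entry, those with \<open>i \<ge> b\<close> to the full row \<open>m - 1 - b\<close> times the diagonal entry of row \<open>b\<close>.  By the
  induction hypothesis the former telescope over \<open>b\<close>, and the latter form the Catalan convolution without its last term.
\<close>

lemma ballot_row_sum: "(\<Sum>j\<le>m. ballot m j) = ballot (Suc m) (Suc m)"
proof (induction m rule: less_induct)
  case (less m)
  have inner: "(\<Sum>i<m. ballot (m - 1 - b) (i - b) * ballot b (min b i)) + ballot b b
      = ballot (Suc b) (Suc b) + ballot (m - b) (m - b) * ballot b b" if b: "b < m" for b
  proof -
    have "(\<Sum>i<m. ballot (m - 1 - b) (i - b) * ballot b (min b i))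
        = (\<Sum>i<b. ballot (m - 1 - b) (i - b) * ballot b (min b i))
          + (\<Sum>i\<in>{b..<m}. ballot (m - 1 - b) (i - b) * ballot b (min b i))"
      unfolding lessThan_atLeast0 by (rule sum.atLeastLessThan_concat[symmetric]) (use b in auto)
    moreover have "(\<Sum>i<b. ballot (m - 1 - b) (i - b) * ballot b (min b i)) = (\<Sum>i<b. ballot b i)"
      by (rule sum.cong) (auto simp: min_absorb2)
    moreover have "(\<Sum>i\<in>{b..<m}. ballot (m - 1 - b) (i - b) * ballot b (min b i))
        = (\<Sum>i\<le>m - 1 - b. ballot (m - 1 - b) i) * ballot b b"
      unfolding sum_distrib_right
      by (rule sum.reindex_bij_witness[of _ "\<lambda>i. i + b" "\<lambda>i. i - b"]) (use b in \<open>auto simp: min_absorb1\<close>)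
    moreover have "(\<Sum>i\<le>m - 1 - b. ballot (m - 1 - b) i) = ballot (m - b) (m - b)"
      using less.IH[of "m - 1 - b"] b by (simp add: Suc_diff_Suc)
    moreover have "(\<Sum>i<b. ballot b i) + ballot b b = ballot (Suc b) (Suc b)"
      using less.IH[OF b] by (simp add: lessThan_Suc_atMost[symmetric])
    ultimately show ?thesis by simp
  qed
  have tel: "(\<Sum>b<m. ballot (Suc b) (Suc b)) + 1 = (\<Sum>b<m. ballot b b) + ballot m m"
    by (induction m) simp_all
  have "(\<Sum>j\<le>m. ballot m j) = 1 + (\<Sum>i<m. ballot m (Suc i))"
    by (simp add: sum.atMost_shift)
  also have "(\<Sum>i<m. ballot m (Suc i))
      = (\<Sum>b<m. \<Sum>i<m. ballot (m - 1 - b) (i - b) * ballot b (min b i))"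
    unfolding ballot_Suc by (rule sum.swap)
  finally have "(\<Sum>j\<le>m. ballot m j) + (\<Sum>b<m. ballot b b)
      = 1 + (\<Sum>b<m. (\<Sum>i<m. ballot (m - 1 - b) (i - b) * ballot b (min b i)) + ballot b b)"
    by (simp add: sum.distrib)
  also have "\<dots> = 1 + (\<Sum>b<m. ballot (Suc b) (Suc b) + ballot (m - b) (m - b) * ballot b b)"
    by (rule arg_cong[where f = "(+) 1"], rule sum.cong[OF refl], rule inner) simp
  also have "\<dots> = (\<Sum>b<m. ballot b b) + (ballot m m + (\<Sum>b<m. ballot (m - b) (m - b) * ballot b b))"
    using tel by (simp add: sum.distrib)
  also have "ballot m m + (\<Sum>b<m. ballot (m - b) (m - b) * ballot b b) = ballot (Suc m) (Suc m)"
    by (simp add: ballot_diagonal_convolution lessThan_Suc_atMost[symmetric] mult.commute)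
  finally show ?case by simp
qed

section \<open>Decomposition of a tail at its minimum\<close>

text \<open>
  An entry of \<open>A\<close>, the minimum \<open>v\<close> and a larger entry of \<open>B\<close> would form 213.  Conversely, let \<open>A\<close> lie above
  \<open>B\<close>.  The last letter of an occurrence of 213 is its largest, so an occurrence that starts in \<open>A\<close> also ends
  there, and none can start with the minimum \<open>v\<close>.
\<close>

lemma avoids213_split_min:
  assumes "distinct (A @ v # B)" "\<forall>x\<in>set A \<union> set B. v < x"
  shows "avoids213 (A @ v # B) \<longleftrightarrow>
           avoids213 A \<and> avoids213 B \<and> (\<forall>b\<in>set B. \<forall>a\<in>set A. b < a)"
  using assms
proof (induction A)
  case Nil
  have "sorted_wrt (\<lambda>a c. \<not> (a < v \<and> v < c)) B"
    using Nil by (intro sorted_wrt_if_all) auto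
  thus ?case by simp
next
  case (Cons x A)
  have "sorted_wrt (\<lambda>a c. \<not> (a < x \<and> x < c)) (A @ v # B)
      \<longleftrightarrow> sorted_wrt (\<lambda>a c. \<not> (a < x \<and> x < c)) A \<and> (\<forall>b\<in>set B. b < x)"
  proof
    assume L: "sorted_wrt (\<lambda>a c. \<not> (a < x \<and> x < c)) (A @ v # B)"
    thus "sorted_wrt (\<lambda>a c. \<not> (a < x \<and> x < c)) A \<and> (\<forall>b\<in>set B. b < x)"
      using Cons.prems by (auto simp: sorted_wrt_append) (metis linorder_less_linear)+
  next
    assume "sorted_wrt (\<lambda>a c. \<not> (a < x \<and> x < c)) A \<and> (\<forall>b\<in>set B. b < x)"
    thus "sorted_wrt (\<lambda>a c. \<not> (a < x \<and> x < c)) (A @ v # B)"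
      using Cons.prems by (auto simp: sorted_wrt_append intro!: sorted_wrt_if_all dest: less_asym)
  qed
  thus ?case using Cons by auto
qed

text \<open>
  If \<open>xs\<close> lists the letters other than \<open>k\<close>, these are the tails of the sortable permutations that start
  with \<open>k\<close>.  Keeping the actual letters, instead of standardising the tail, and allowing any list of
  them lets the decomposition below stay inside this family.
\<close>

definition tails :: "nat \<Rightarrow> nat list \<Rightarrow> nat list set" where
  "tails k xs = {\<rho>. mset \<rho> = mset xs \<and> avoids213 \<rho> \<and> descents_into k \<rho>}"

lemma finite_tails: "finite (tails k xs)"
  by (rule finite_subset[OF _ finite_permutations_of_multiset[of "mset xs"]])
     (auto simp: tails_def permutations_of_multiset_def)

text \<open>
  Every descent would end above \<open>k\<close>, so there is none.
\<close>

lemma tails_above: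
  assumes "sorted_wrt (<) xs" "\<forall>x\<in>set xs. k < x"
  shows "tails k xs = {xs}"
proof
  show "{xs} \<subseteq> tails k xs"
  proof -
    have "avoids213 xs"
      using assms(1) by (induction xs) (auto intro!: sorted_wrt_if_all)
    moreover have "descents_into k xs"
      using assms(1) by (intro successively_if_sorted_wrt) (auto elim: sorted_wrt_mono_rel[rotated])
    ultimately show ?thesis by (simp add: tails_def)
  qed
  show "tails k xs \<subseteq> {xs}"
  proof
    fix \<rho> assume "\<rho> \<in> tails k xs"
    hence m: "mset \<rho> = mset xs" and d: "descents_into k \<rho>"
      by (auto simp: tails_def)
    have s: "set \<rho> = set xs" using m by (rule mset_eq_setD)
    have "successively (\<le>) \<rho>"
      using d by (rule successively_mono) (use assms(2) s in \<open>auto simp: not_less[symmetric]\<close>)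
    hence "sorted \<rho>"
      by (simp add: successively_conv_sorted_wrt)
    thus "\<rho> \<in> {xs}"
      using m assms(1) by (metis properties_for_sort singletonI sorted_sort_id strict_sorted_imp_sorted)
  qed
qed

text \<open>
  As \<open>B\<close> lies below \<open>A\<close>, its letters are the \<open>b\<close> smallest ones of the sorted list \<open>ys\<close>.  The descent into \<open>v\<close>
  is allowed because \<open>v < k\<close>, and the step from \<open>v\<close> to \<open>B\<close> is an ascent.
\<close>

lemma tails_split_min:
  assumes sorted: "sorted_wrt (<) (v # ys)" and vk: "v < k"
  shows "bij_betw (\<lambda>(b, A, B). A @ v # B)
           (SIGMA b:{..length ys}. tails k (drop b ys) \<times> tails k (take b ys)) (tails k (v # ys))"
  unfolding bij_betw_def
proof
  let ?D = "SIGMA b:{..length ys}. tails k (drop b ys) \<times> tails k (take b ys)"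
  have dist: "distinct (v # ys)" using sorted by (simp only: strict_sorted_iff)
  have min: "\<forall>y\<in>set ys. v < y" using sorted by simp
  have sy: "sorted ys" using sorted by (auto simp: strict_sorted_iff)
  show "inj_on (\<lambda>(b, A, B). A @ v # B) ?D"
  proof (rule inj_onI, clarsimp)
    fix b A B b' A' B'
    assume b: "b \<le> length ys" and b': "b' \<le> length ys"
      and A: "A \<in> tails k (drop b ys)" and B: "B \<in> tails k (take b ys)"
      and A': "A' \<in> tails k (drop b' ys)" and B': "B' \<in> tails k (take b' ys)"
      and eq: "A @ v # B = A' @ v # B'"
    have "v \<notin> set A" "v \<notin> set B"
      using A B dist by (auto simp: tails_def dest!: mset_eq_setD dest: in_set_dropD in_set_takeD)
    hence 1: "A = A'" "B = B'"
      using eq by (auto simp: append_Cons_eq_iff)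
    have "length B = b" "length B' = b'"
      using B B' b b' by (auto simp: tails_def dest!: mset_eq_length)
    with 1 show "b = b' \<and> A = A' \<and> B = B'" by simp
  qed
  show "(\<lambda>(b, A, B). A @ v # B) ` ?D = tails k (v # ys)"
  proof
    show "(\<lambda>(b, A, B). A @ v # B) ` ?D \<subseteq> tails k (v # ys)"
    proof clarsimp
      fix b A B assume b: "b \<le> length ys"
        and A: "A \<in> tails k (drop b ys)" and B: "B \<in> tails k (take b ys)"
      have m: "mset A = mset (drop b ys)" "mset B = mset (take b ys)"
        using A B by (auto simp: tails_def)
      have s: "set A = set (drop b ys)" "set B = set (take b ys)"
        using m by (auto dest: mset_eq_setD)
      have "mset (take b ys) + mset (drop b ys) = mset ys"
        by (metis append_take_drop_id mset_append)
      hence mm: "mset (A @ v # B) = mset (v # ys)"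
        by (simp add: m add.commute)
      hence d: "distinct (A @ v # B)" using dist by (metis mset_eq_imp_distinct_iff)
      have lt: "\<forall>y\<in>set B. \<forall>a\<in>set A. y < a"
        using sorted unfolding s by (metis append_take_drop_id sorted_wrt.simps(2) sorted_wrt_append)
      have "\<forall>x\<in>set A \<union> set B. v < x"
        unfolding s using min by (auto dest: in_set_dropD in_set_takeD)
      moreover from this have "B \<noteq> [] \<Longrightarrow> v < hd B" by auto
      ultimately show "A @ v # B \<in> tails k (v # ys)"
        using A B mm d lt vk avoids213_split_min[of A v B]
        by (auto simp: tails_def successively_append_iff successively_Cons)
    qed
    show "tails k (v # ys) \<subseteq> (\<lambda>(b, A, B). A @ v # B) ` ?D"
    proof
      fix \<rho> assume \<rho>: "\<rho> \<in> tails k (v # ys)"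
      hence m: "mset \<rho> = mset (v # ys)" and av: "avoids213 \<rho>" and de: "descents_into k \<rho>"
        by (auto simp: tails_def)
      have "v \<in> set \<rho>" using m by (metis list.set_intros(1) mset_eq_setD)
      then obtain A B where \<rho>_eq: "\<rho> = A @ v # B" by (auto simp: in_set_conv_decomp)
      have mAB: "mset (B @ A) = mset ys" using m by (simp add: \<rho>_eq add.commute)
      have sAB: "set A \<union> set B = set ys" using mset_eq_setD[OF mAB] by auto
      have d: "distinct (A @ v # B)" using dist m \<rho>_eq by (metis mset_eq_imp_distinct_iff)
      have split: "avoids213 A" "avoids213 B" "\<forall>b\<in>set B. \<forall>a\<in>set A. b < a"
        using avoids213_split_min[OF d] min sAB av \<rho>_eq by auto
      \<comment> \<open>\<open>B\<close> lies below \<open>A\<close>, so sorting both sides separately sorts all letters\<close>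
      have "sort B @ sort A = ys"
      proof -
        have "sorted (sort B @ sort A)"
          using split(3) by (auto simp: sorted_append intro: less_imp_le)
        thus ?thesis
          using mAB sy by (metis mset_append mset_sort properties_for_sort sorted_sort_id)
      qed
      hence "take (length B) ys = sort B" "drop (length B) ys = sort A"
        by (metis append_eq_conv_conj length_sort)+
      moreover have "descents_into k A" "descents_into k B"
        using de by (auto simp: \<rho>_eq successively_append_iff successively_Cons)
      moreover have "length B \<le> length ys" using mset_eq_length[OF mAB] by simp
      ultimately have "(length B, A, B) \<in> ?D"
        using split by (auto simp: tails_def)
      thus "\<rho> \<in> (\<lambda>(b, A, B). A @ v # B) ` ?D"
        by (auto simp: \<rho>_eq image_iff intro!: bexI[of _ "(length B, A, B)"])
    qed
  qed
qed

section \<open>Counting tails\<close>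

abbreviation number_below :: "nat \<Rightarrow> nat list \<Rightarrow> nat" where
  "number_below k xs \<equiv> length (filter (\<lambda>x. x < k) xs)"

lemma number_below_take_drop:
  assumes "sorted_wrt (<) xs"
  shows "number_below k (take b xs) = min b (number_below k xs)"
    and "number_below k (drop b xs) = number_below k xs - b"
proof -
  have "number_below k (take b xs) = min b (number_below k xs)
      \<and> number_below k (drop b xs) = number_below k xs - b"
    using assms
  proof (induction xs arbitrary: b)
    case (Cons x xs)
    have "\<not> x < k \<Longrightarrow> filter (\<lambda>x. x < k) xs = []"
      using Cons.prems by (auto simp: filter_empty_conv)
    moreover from this have "\<not> x < k \<Longrightarrow> filter (\<lambda>x. x < k) (take c xs) = []
        \<and> filter (\<lambda>x. x < k) (drop c xs) = []" for c
      by (auto simp: filter_empty_conv dest: in_set_takeD in_set_dropD)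
    ultimately show ?case
      using Cons by (cases b) auto
  qed simp
  thus "number_below k (take b xs) = min b (number_below k xs)"
    and "number_below k (drop b xs) = number_below k xs - b" by auto
qed

lemma card_tails:
  assumes "sorted_wrt (<) xs" "k \<notin> set xs"
  shows "card (tails k xs) = ballot (length xs) (number_below k xs)"
  using assms
proof (induction xs rule: length_induct)
  case (1 xs)
  show ?case
  proof (cases "\<forall>x\<in>set xs. k < x")
    case True
    hence "filter (\<lambda>x. x < k) xs = []" by (auto simp: filter_empty_conv)
    thus ?thesis using tails_above[OF 1(2) True] by simp
  next
    case False
    then obtain v ys where xs: "xs = v # ys" by (cases xs) auto
    have vk: "v < k" using False 1(2,3) by (auto simp: xs)
    have sy: "sorted_wrt (<) ys" using 1(2) xs by simp
    have nk: "k \<notin> set (drop b ys)" "k \<notin> set (take b ys)" for b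
      using 1(3) set_drop_subset[of b ys] set_take_subset[of b ys] by (auto simp: xs)
    have sub: "sorted_wrt (<) (drop b ys)" "sorted_wrt (<) (take b ys)" for b
      using sy by (auto simp: sorted_wrt_drop sorted_wrt_take)
    have "card (tails k xs)
        = card (SIGMA b:{..length ys}. tails k (drop b ys) \<times> tails k (take b ys))"
      using bij_betw_same_card[OF tails_split_min[OF _ vk, of ys]] 1(2) by (simp add: xs)
    also have "\<dots> = (\<Sum>b\<le>length ys. card (tails k (drop b ys)) * card (tails k (take b ys)))"
      by (simp add: finite_tails card_cartesian_product)
    also have "\<dots> = (\<Sum>b<length xs. ballot (length xs - 1 - b) (number_below k ys - b)
                      * ballot b (min b (number_below k ys)))"
    proof (rule sum.cong)
      fix b assume "b \<in> {..<length xs}"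
      hence b: "b \<le> length ys" by (simp add: xs)
      have "card (tails k (drop b ys)) = ballot (length (drop b ys)) (number_below k (drop b ys))"
        using 1(1)[rule_format, of "drop b ys"] sub nk by (simp add: xs less_Suc_eq_le)
      moreover have "card (tails k (take b ys)) = ballot (length (take b ys)) (number_below k (take b ys))"
        using 1(1)[rule_format, of "take b ys"] sub nk b by (simp add: xs)
      ultimately show "card (tails k (drop b ys)) * card (tails k (take b ys))
          = ballot (length xs - 1 - b) (number_below k ys - b) * ballot b (min b (number_below k ys))"
        using b by (simp add: number_below_take_drop[OF sy] xs min_absorb2)
    qed (auto simp: xs)
    also have "\<dots> = ballot (length xs) (number_below k xs)"
      using vk by (simp add: xs ballot_Suc)
    finally show ?thesis .
  qed
qed

text \<open>
  If \<open>v < k\<close>, the first letter is above \<open>k\<close> iff \<open>A\<close> is nonempty and starts above \<open>k\<close>, so the recursion is that of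
  \<open>card_tails\<close> with the factor for \<open>A\<close> replaced.  It matches the recursion of row \<open>length xs - 1\<close>,
  which reflects that, up to order isomorphism, deleting the first letter is a bijection from these tails to
  all tails with one letter above \<open>k\<close> fewer.
\<close>

lemma card_tails_hd_above:
  assumes "sorted_wrt (<) xs" "k \<notin> set xs"
  shows "card {\<rho> \<in> tails k xs. \<rho> \<noteq> [] \<and> k < hd \<rho>}
       = (if number_below k xs < length xs then ballot (length xs - 1) (number_below k xs) else 0)"
  using assms
proof (induction xs rule: length_induct)
  case (1 xs)
  let ?H = "\<lambda>xs. {\<rho> \<in> tails k xs. \<rho> \<noteq> [] \<and> k < hd \<rho>}"
  show ?case
  proof (cases "\<forall>x\<in>set xs. k < x")
    case True
    hence "filter (\<lambda>x. x < k) xs = []" by (auto simp: filter_empty_conv)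
    moreover have "?H xs = (if xs = [] then {} else {xs})"
      using tails_above[OF 1(2) True] True by (cases xs) auto
    ultimately show ?thesis by auto
  next
    case False
    then obtain v ys where xs: "xs = v # ys" by (cases xs) auto
    have vk: "v < k" using False 1(2,3) by (auto simp: xs)
    have sy: "sorted_wrt (<) ys" using 1(2) xs by simp
    have nk: "k \<notin> set (drop b ys)" "k \<notin> set (take b ys)" for b
      using 1(3) set_drop_subset[of b ys] set_take_subset[of b ys] by (auto simp: xs)
    have sub: "sorted_wrt (<) (drop b ys)" "sorted_wrt (<) (take b ys)" for b
      using sy by (auto simp: sorted_wrt_drop sorted_wrt_take)
    define j m where "j = number_below k ys" and "m = length ys"
    have jm: "j \<le> m" by (simp add: j_def m_def)
    let ?f = "\<lambda>(b, A, B). A @ v # B"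
    let ?D = "SIGMA b:{..m}. tails k (drop b ys) \<times> tails k (take b ys)"
    let ?E = "SIGMA b:{..m}. ?H (drop b ys) \<times> tails k (take b ys)"
    have bij: "bij_betw ?f ?D (tails k xs)"
      using tails_split_min[OF _ vk] 1(2) xs by (simp add: m_def)
    have "?f ` ?E = ?H xs"
    proof
      show "?f ` ?E \<subseteq> ?H xs"
      proof
        fix \<rho> assume "\<rho> \<in> ?f ` ?E"
        then obtain p where p: "p \<in> ?E" "\<rho> = ?f p" by blast
        hence "\<rho> \<in> tails k xs" using bij_betwE[OF bij] by blast
        thus "\<rho> \<in> ?H xs" using p by auto
      qed
      show "?H xs \<subseteq> ?f ` ?E"
      proof
        fix \<rho> assume \<rho>: "\<rho> \<in> ?H xs"
        hence "\<rho> \<in> ?f ` ?D" using bij by (auto simp: bij_betw_def)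
        then obtain p where p: "p \<in> ?D" "\<rho> = ?f p" by blast
        have "p \<in> ?E" using p \<rho> vk by (cases "fst (snd p) = []") auto
        thus "\<rho> \<in> ?f ` ?E" using p by blast
      qed
    qed
    moreover have "inj_on ?f ?E"
      by (rule inj_on_subset[of _ ?D]) (use bij in \<open>auto simp: bij_betw_def\<close>)
    ultimately have "card (?H xs) = card ?E"
      using card_image[of ?f ?E] by simp
    also have "\<dots> = (\<Sum>b\<le>m. card (?H (drop b ys)) * card (tails k (take b ys)))"
      by (simp add: finite_tails card_cartesian_product)
    also have "\<dots> = (\<Sum>b\<le>m. (if j - b < m - b then ballot (m - 1 - b) (j - b) else 0)
                      * ballot b (min b j))"
    proof (rule sum.cong[OF refl])
      fix b assume "b \<in> {..m}"
      hence b: "b \<le> length ys" by (simp add: m_def)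
      have "card (?H (drop b ys)) = (if j - b < m - b then ballot (m - b - 1) (j - b) else 0)"
        using 1(1)[rule_format, of "drop b ys"] sub nk
        by (simp add: xs j_def m_def number_below_take_drop[OF sy] less_Suc_eq_le)
      moreover have "card (tails k (take b ys)) = ballot b (min b j)"
        using card_tails[of "take b ys" k] sub nk b
        by (simp add: j_def number_below_take_drop[OF sy] min_absorb2)
      ultimately show "card (?H (drop b ys)) * card (tails k (take b ys))
          = (if j - b < m - b then ballot (m - 1 - b) (j - b) else 0) * ballot b (min b j)"
        by simp
    qed
    \<comment> \<open>the term \<open>b = m\<close> vanishes, and the side conditions on the others all amount to \<open>j < m\<close>\<close>
    also have "\<dots> = (if j < m then ballot m (Suc j) else 0)"
    proof (cases "j < m")
      case True
      have "(\<Sum>b\<le>m. (if j - b < m - b then ballot (m - 1 - b) (j - b) else 0) * ballot b (min b j))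
          = (\<Sum>b<m. (if j - b < m - b then ballot (m - 1 - b) (j - b) else 0) * ballot b (min b j))"
        by (simp add: lessThan_Suc_atMost[symmetric])
      also have "\<dots> = (\<Sum>b<m. ballot (m - 1 - b) (j - b) * ballot b (min b j))"
        using True by (intro sum.cong) auto
      finally show ?thesis using True by (simp add: ballot_Suc)
    qed (use jm in auto)
    finally show ?thesis
      using vk by (simp add: xs j_def m_def)
  qed
qed

section \<open>Counting permutations\<close>

text \<open>
  The list \<open>[1..<k] @ [Suc k..<Suc n]\<close> enumerates, in increasing order, the letters left for the tail.
\<close>

lemma mset_upt_omit_iff:
  assumes "k \<in> {1..n}"
  shows "mset \<rho> = mset ([1..<k] @ [Suc k..<Suc n]) \<longleftrightarrow> distinct (k # \<rho>) \<and> set (k # \<rho>) = {1..n}"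
proof -
  let ?xs = "[1..<k] @ [Suc k..<Suc n]"
  have d: "distinct ?xs" by auto
  have s: "set ?xs = {1..n} - {k}" using assms by auto
  have "mset \<rho> = mset ?xs \<longleftrightarrow> distinct \<rho> \<and> set \<rho> = set ?xs"
    using d set_eq_iff_mset_eq_distinct[of \<rho> ?xs] by (metis mset_eq_imp_distinct_iff mset_eq_setD)
  also have "\<dots> \<longleftrightarrow> distinct (k # \<rho>) \<and> set (k # \<rho>) = {1..n}"
    unfolding s distinct.simps list.set using assms by blast
  finally show ?thesis .
qed

lemma card_permutations_by_head:
  assumes "n \<ge> 1"
  shows "card {\<pi> \<in> permutations_of_set {1..n}. Q \<pi>}
       = (\<Sum>k\<in>{1..n}. card {\<rho>. mset \<rho> = mset ([1..<k] @ [Suc k..<Suc n]) \<and> Q (k # \<rho>)})"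
proof -
  let ?R = "\<lambda>k. {\<rho>. mset \<rho> = mset ([1..<k] @ [Suc k..<Suc n]) \<and> Q (k # \<rho>)}"
  have image: "{\<pi> \<in> permutations_of_set {1..n}. Q \<pi>} = (\<lambda>(k, \<rho>). k # \<rho>) ` (SIGMA k:{1..n}. ?R k)"
  proof (intro set_eqI iffI)
    fix \<pi> assume \<pi>: "\<pi> \<in> {\<pi> \<in> permutations_of_set {1..n}. Q \<pi>}"
    hence p: "distinct \<pi>" "set \<pi> = {1..n}" "Q \<pi>" by (auto simp: permutations_of_set_def)
    then obtain k \<rho> where k\<rho>: "\<pi> = k # \<rho>" using assms by (cases \<pi>) auto
    moreover have k: "k \<in> {1..n}" using p(2) k\<rho> by auto
    ultimately have "(k, \<rho>) \<in> (SIGMA k:{1..n}. ?R k)"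
      using p mset_upt_omit_iff[OF k, of \<rho>] by simp
    thus "\<pi> \<in> (\<lambda>(k, \<rho>). k # \<rho>) ` (SIGMA k:{1..n}. ?R k)"
      by (rule image_eqI[rotated]) (simp add: k\<rho>)
  next
    fix \<pi> assume "\<pi> \<in> (\<lambda>(k, \<rho>). k # \<rho>) ` (SIGMA k:{1..n}. ?R k)"
    then obtain k \<rho> where "\<pi> = k # \<rho>" "k \<in> {1..n}" "\<rho> \<in> ?R k" by auto
    thus "\<pi> \<in> {\<pi> \<in> permutations_of_set {1..n}. Q \<pi>}"
      using mset_upt_omit_iff[of k n \<rho>] by (auto simp: permutations_of_set_def)
  qed
  have inj: "inj_on (\<lambda>(k, \<rho>). k # \<rho>) (SIGMA k:{1..n}. ?R k)"
    by (auto simp: inj_on_def)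
  have fin: "finite (?R k)" for k
    by (rule finite_subset[OF _ finite_permutations_of_multiset[of "mset ([1..<k] @ [Suc k..<Suc n])"]])
       (auto simp: permutations_of_multiset_def)
  show ?thesis
    unfolding image card_image[OF inj] by (rule card_SigmaI, simp, intro ballI fin)
qed

lemma upt_omit_facts:
  assumes "k \<in> {s..n}"
  shows "sorted_wrt (<) ([s..<k] @ [Suc k..<Suc n])" "k \<notin> set ([s..<k] @ [Suc k..<Suc n])"
    "number_below k ([s..<k] @ [Suc k..<Suc n]) = k - s" "length ([s..<k] @ [Suc k..<Suc n]) = n - s"
proof -
  have "filter (\<lambda>x. x < k) [s..<k] = [s..<k]" "filter (\<lambda>x. x < k) [Suc k..<Suc n] = []"
    by (auto simp: filter_id_conv filter_empty_conv simp del: upt_Suc)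
  thus "number_below k ([s..<k] @ [Suc k..<Suc n]) = k - s"
    by (simp del: upt_Suc)
qed (use assms in \<open>auto simp: sorted_wrt_append simp del: upt_Suc\<close>)

lemma f_count_ballot:
  assumes "n \<ge> 1"
  shows "f_count n = ballot n n"
proof -
  have "card {\<rho>. mset \<rho> = mset ([1..<k] @ [Suc k..<Suc n]) \<and> sortable {[1, 2, 3], [1, 3, 2]} (k # \<rho>)}
      = ballot (n - 1) (k - 1)" if k: "k \<in> {1..n}" for k
  proof -
    have "{\<rho>. mset \<rho> = mset ([1..<k] @ [Suc k..<Suc n]) \<and> sortable {[1, 2, 3], [1, 3, 2]} (k # \<rho>)}
        = tails k ([1..<k] @ [Suc k..<Suc n])"
      unfolding tails_def using sortable_iff mset_upt_omit_iff[OF k] by (intro Collect_cong) blast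
    thus ?thesis
      using card_tails[OF upt_omit_facts(1,2)[OF k]] upt_omit_facts(3,4)[OF k] by simp
  qed
  hence "f_count n = (\<Sum>k\<in>{1..n}. ballot (n - 1) (k - 1))"
    unfolding f_count_def card_permutations_by_head[OF assms] by (rule sum.cong[OF refl])
  also have "\<dots> = (\<Sum>j\<le>n - 1. ballot (n - 1) j)"
    by (rule sum.reindex_bij_witness[of _ Suc "\<lambda>k. k - 1"]) (use assms in auto)
  also have "\<dots> = ballot n n"
    using assms by (simp add: ballot_row_sum)
  finally show ?thesis .
qed

text \<open>
  A leading 1 in a tail neither takes part in an occurrence of 213 nor is it followed by a descent, and the
  descent into it is harmless as \<open>k \<ge> 2\<close>.  So it can be removed, which leaves an arbitrary tail with one
  letter below \<open>k\<close> fewer.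
\<close>

lemma h_count_ballot:
  assumes "n \<ge> 1"
  shows "h_count (n + 1) = ballot n n"
proof -
  let ?Q = "\<lambda>\<pi>. \<not> contains_xi \<pi> \<and> \<not> contains_star213 \<pi> \<and> length \<pi> \<ge> 2 \<and> \<pi> ! 1 = 1"
  let ?R = "\<lambda>k. {\<rho>. mset \<rho> = mset ([1..<k] @ [Suc k..<Suc (n + 1)]) \<and> ?Q (k # \<rho>)}"
  have "h_count (n + 1) = card {\<pi> \<in> permutations_of_set {1..n + 1}. ?Q \<pi>}"
    unfolding h_count_def av_xi_star213_def by (rule arg_cong[where f = card]) blast
  also have "\<dots> = (\<Sum>k\<in>{1..n + 1}. card (?R k))"
    by (rule card_permutations_by_head) simp
  also have "\<dots> = (\<Sum>k\<in>{2..n + 1}. card (?R k))"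
  proof (rule sum.mono_neutral_right)
    show "\<forall>k\<in>{1..n + 1} - {2..n + 1}. card (?R k) = 0"
    proof
      fix k assume "k \<in> {1..n + 1} - {2..n + 1}"
      hence k: "k = 1" "k \<in> {1..n + 1}" by auto
      have False if \<rho>: "\<rho> \<in> ?R k" for \<rho>
      proof -
        have "distinct (k # \<rho>)" using \<rho> mset_upt_omit_iff[OF k(2), of \<rho>] by blast
        moreover have "\<rho> \<noteq> []" "hd \<rho> = 1" using \<rho> by (cases \<rho>; auto)+
        ultimately show False using k(1) by (metis distinct.simps(2) hd_in_set)
      qed
      hence "?R k = {}" by blast
      thus "card (?R k) = 0" by (simp only: card.empty)
    qed
  qed auto
  also have "\<dots> = (\<Sum>k\<in>{2..n + 1}. ballot (n - 1) (k - 2))"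
  proof (rule sum.cong[OF refl])
    fix k assume k: "k \<in> {2..n + 1}"
    hence k1: "k \<in> {1..n + 1}" by auto
    let ?ys = "[2..<k] @ [Suc k..<Suc (n + 1)]"
    have xs: "[1..<k] @ [Suc k..<Suc (n + 1)] = 1 # ?ys"
      using k by (simp add: upt_conv_Cons numeral_2_eq_2 del: upt_Suc)
    have "?R k = (#) 1 ` tails k ?ys"
    proof (intro set_eqI iffI)
      fix \<rho> assume \<rho>: "\<rho> \<in> ?R k"
      then obtain \<rho>' where \<rho>': "\<rho> = 1 # \<rho>'" by (cases \<rho>) auto
      have "distinct (k # \<rho>)" using \<rho> mset_upt_omit_iff[OF k1, of \<rho>] by blast
      hence "avoids213 \<rho>" "descents_into k \<rho>"
        using \<rho> contains_star213_Cons[of k \<rho>] contains_xi_Cons[of k \<rho>] by auto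
      moreover have "mset \<rho>' = mset ?ys" using \<rho> unfolding xs \<rho>' by simp
      ultimately have "\<rho>' \<in> tails k ?ys"
        by (auto simp: tails_def \<rho>' successively_Cons)
      thus "\<rho> \<in> (#) 1 ` tails k ?ys" using \<rho>' by blast
    next
      fix \<rho> assume "\<rho> \<in> (#) 1 ` tails k ?ys"
      then obtain \<rho>' where \<rho>': "\<rho> = 1 # \<rho>'" "\<rho>' \<in> tails k ?ys" by blast
      have m: "mset \<rho> = mset ([1..<k] @ [Suc k..<Suc (n + 1)])"
        unfolding xs \<rho>'(1) using \<rho>'(2) by (simp add: tails_def)
      hence d: "distinct (k # \<rho>)" "set (k # \<rho>) = {1..n + 1}"
        using mset_upt_omit_iff[OF k1, of \<rho>] by blast+
      have pos: "\<forall>x\<in>set \<rho>'. 1 \<le> x" using d(2) \<rho>'(1) by auto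
      hence "avoids213 \<rho>"
        using \<rho>' by (auto simp: tails_def not_less intro!: sorted_wrt_if_all)
      moreover have "descents_into k \<rho>"
        using \<rho>' k by (auto simp: tails_def successively_Cons)
      ultimately show "\<rho> \<in> ?R k"
        using m d(1) contains_star213_Cons[of k \<rho>] contains_xi_Cons[of k \<rho>] \<rho>'(1) by auto
    qed
    hence "card (?R k) = card (tails k ?ys)"
      by (simp add: card_image)
    also have "\<dots> = ballot (n - 1) (k - 2)"
      using card_tails[OF upt_omit_facts(1,2)[OF k]] upt_omit_facts(3,4)[OF k] by simp
    finally show "card (?R k) = ballot (n - 1) (k - 2)" .
  qed
  also have "\<dots> = (\<Sum>j\<le>n - 1. ballot (n - 1) j)"
    by (rule sum.reindex_bij_witness[of _ "\<lambda>j. j + 2" "\<lambda>k. k - 2"]) (use assms in auto)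
  also have "\<dots> = ballot n n"
    using assms by (simp add: ballot_row_sum)
  finally show ?thesis .
qed

text \<open>
  The first entry is always a left-to-right minimum.  The first block is empty, and followed by another
  minimum, iff the second entry is a minimum as well.
\<close>

lemma first_block_empty_iff:
  assumes "distinct (k # \<rho>)"
  shows "length (ltr_min_positions (k # \<rho>)) \<ge> 2 \<and> ltr_block (k # \<rho>) 1 = []
     \<longleftrightarrow> \<rho> \<noteq> [] \<and> hd \<rho> < k"
proof (cases \<rho>)
  case Nil
  thus ?thesis by (simp add: ltr_min_positions_def)
next
  case (Cons x \<sigma>)
  define \<pi> where "\<pi> = k # x # \<sigma>"
  define qs where "qs = filter (\<lambda>i. \<forall>j<i. \<pi> ! i < \<pi> ! j) [2..<length \<pi>]"
  have "[0..<length \<pi>] = 0 # 1 # [2..<length \<pi>]"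
    by (simp add: \<pi>_def upt_rec[of 0] upt_rec[of "Suc 0"] numeral_2_eq_2 del: upt_Suc)
  moreover have "(\<forall>j<1. \<pi> ! 1 < \<pi> ! j) \<longleftrightarrow> x < k"
    by (simp add: \<pi>_def)
  ultimately have ps: "ltr_min_positions \<pi> = (if x < k then 0 # 1 # qs else 0 # qs)"
    unfolding ltr_min_positions_def qs_def by simp
  show ?thesis
  proof (cases "x < k")
    case True
    have "{0<..<Suc 0} = {}" by auto
    thus ?thesis using True Cons ps by (simp add: ltr_block_def \<pi>_def[symmetric])
  next
    case False
    have "ltr_block \<pi> 1 \<noteq> []" if two: "length (ltr_min_positions \<pi>) \<ge> 2"
    proof -
      obtain q qs' where q: "qs = q # qs'" using two ps False by (cases qs) auto
      have "set qs \<subseteq> {2..<length \<pi>}" unfolding qs_def set_filter set_upt by blast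
      hence "2 \<le> q" using q by simp
      moreover have "ltr_block \<pi> 1 = nths \<pi> {0<..<q}"
        by (simp add: ltr_block_def ps False q)
      moreover have "x \<in> set (nths \<pi> {0<..<q})" if "2 \<le> q"
        unfolding set_nths using that by (auto simp: \<pi>_def intro!: exI[of _ 1])
      ultimately show ?thesis by (metis empty_iff empty_set)
    qed
    thus ?thesis using False Cons by (auto simp: \<pi>_def)
  qed
qed

text \<open>
  A tail starts either below or above \<open>k\<close>.  The first kind is counted by \<open>g\<close>, both kinds together by \<open>f\<close>, and
  the second kind, by \<open>card_tails_hd_above\<close>, by the row of ballot numbers with index \<open>n - 1\<close>.
\<close>

lemma g_count_ballot:
  assumes "n \<ge> 1"
  shows "g_count (n + 1) + ballot n n = ballot (n + 1) (n + 1)"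
proof -
  let ?xs = "\<lambda>k. [1..<k] @ [Suc k..<Suc (n + 1)]"
  let ?Q = "\<lambda>\<pi>. sortable {[1, 2, 3], [1, 3, 2]} \<pi> \<and>
     length (ltr_min_positions \<pi>) \<ge> 2 \<and> ltr_block \<pi> 1 = []"
  have key: "card {\<rho>. mset \<rho> = mset (?xs k) \<and> ?Q (k # \<rho>)}
      + (if k - 1 < n then ballot (n - 1) (k - 1) else 0) = ballot n (k - 1)"
    if k: "k \<in> {1..n + 1}" for k
  proof -
    let ?G = "{\<rho>. mset \<rho> = mset (?xs k) \<and> ?Q (k # \<rho>)}"
    let ?H = "{\<rho> \<in> tails k (?xs k). \<rho> \<noteq> [] \<and> k < hd \<rho>}"
    have G: "?G = {\<rho> \<in> tails k (?xs k). \<rho> \<noteq> [] \<and> hd \<rho> < k}"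
      unfolding tails_def using sortable_iff mset_upt_omit_iff[OF k] first_block_empty_iff by blast
    have union: "tails k (?xs k) = ?G \<union> ?H"
    proof -
      have "\<rho> \<noteq> [] \<and> (hd \<rho> < k \<or> k < hd \<rho>)" if "\<rho> \<in> tails k (?xs k)" for \<rho>
      proof -
        have m: "mset \<rho> = mset (?xs k)" using that by (simp add: tails_def)
        have "length \<rho> = n" using mset_eq_length[OF m] upt_omit_facts(4)[OF k] by simp
        hence "\<rho> \<noteq> []" using assms by auto
        moreover have "distinct (k # \<rho>)" using m mset_upt_omit_iff[OF k] by blast
        ultimately show ?thesis by (metis distinct.simps(2) hd_in_set linorder_neqE_nat)
      qed
      thus ?thesis unfolding G by blast
    qed
    have "card (?G \<union> ?H) = card ?G + card ?H"
    proof (rule card_Un_disjoint)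
      show "finite ?G" "finite ?H" "?G \<inter> ?H = {}"
        unfolding G by (simp add: finite_tails, simp add: finite_tails, blast dest: less_asym)
    qed
    hence "card (tails k (?xs k)) = card ?G + card ?H"
      by (rule trans[OF arg_cong[OF union, of card]])
    moreover have "card (tails k (?xs k)) = ballot n (k - 1)"
      using card_tails[OF upt_omit_facts(1,2)[OF k]] upt_omit_facts(3,4)[OF k] by simp
    moreover have "card ?H = (if k - 1 < n then ballot (n - 1) (k - 1) else 0)"
      unfolding card_tails_hd_above[OF upt_omit_facts(1,2)[OF k]] upt_omit_facts(3,4)[OF k] by simp
    ultimately show ?thesis by simp
  qed
  have "g_count (n + 1) = (\<Sum>k\<in>{1..n + 1}. card {\<rho>. mset \<rho> = mset (?xs k) \<and> ?Q (k # \<rho>)})"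
    unfolding g_count_def by (rule card_permutations_by_head) simp
  moreover have "(\<Sum>k\<in>{1..n + 1}. if k - 1 < n then ballot (n - 1) (k - 1) else 0) = ballot n n"
  proof -
    have "(\<Sum>k\<in>{1..n + 1}. if k - 1 < n then ballot (n - 1) (k - 1) else 0)
        = (\<Sum>j\<le>n. if j < n then ballot (n - 1) j else 0)"
      by (rule sum.reindex_bij_witness[of _ Suc "\<lambda>k. k - 1"]) auto
    also have "\<dots> = (\<Sum>j\<le>n - 1. ballot (n - 1) j)"
      by (rule sum.mono_neutral_cong_right) (use assms in auto)
    finally show ?thesis using assms by (simp add: ballot_row_sum)
  qed
  moreover have "(\<Sum>k\<in>{1..n + 1}. ballot n (k - 1)) = ballot (n + 1) (n + 1)"
  proof -
    have "(\<Sum>k\<in>{1..n + 1}. ballot n (k - 1)) = (\<Sum>j\<le>n. ballot n j)"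
      by (rule sum.reindex_bij_witness[of _ Suc "\<lambda>k. k - 1"]) auto
    thus ?thesis by (simp add: ballot_row_sum)
  qed
  moreover have "(\<Sum>k\<in>{1..n + 1}. card {\<rho>. mset \<rho> = mset (?xs k) \<and> ?Q (k # \<rho>)}
      + (if k - 1 < n then ballot (n - 1) (k - 1) else 0)) = (\<Sum>k\<in>{1..n + 1}. ballot n (k - 1))"
    by (rule sum.cong[OF refl key])
  ultimately show ?thesis
    by (simp only: sum.distrib)
qed

lemma length_permutation_1: "\<pi> \<in> permutations_of_set {1..1::nat} \<Longrightarrow> length \<pi> = 1"
  by (drule length_finite_permutations_of_set) simp

lemma h_count_1: "h_count 1 = 0"
proof -
  have "{\<pi> \<in> av_xi_star213 1. length \<pi> \<ge> 2 \<and> \<pi> ! 1 = 1} = {}"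
    unfolding av_xi_star213_def using length_permutation_1 by fastforce
  thus ?thesis by (simp only: h_count_def card.empty)
qed

lemma g_count_1: "g_count 1 = 0"
proof -
  have "length (ltr_min_positions \<pi>) \<le> 1" if "\<pi> \<in> permutations_of_set {1..1}" for \<pi>
    using length_filter_le[of _ "[0..<length \<pi>]"] length_permutation_1[OF that]
    by (simp add: ltr_min_positions_def)
  hence "{\<pi> \<in> permutations_of_set {1..1}. sortable {[1,2,3], [1,3,2]} \<pi> \<and>
     length (ltr_min_positions \<pi>) \<ge> 2 \<and> ltr_block \<pi> 1 = []} = {}"
    by fastforce
  thus ?thesis by (simp only: g_count_def card.empty)
qed

theorem theorem6p19:
  shows "(h_count 1 = 0 \<and> (\<forall>n\<ge>1. real (h_count (n + 1)) = catalan n)) \<and>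
         (g_count 1 = 0 \<and> (\<forall>n\<ge>1. real (g_count (n + 1)) = catalan (n + 1) - catalan n)) \<and>
         (\<forall>n\<ge>1. real (f_count n) = catalan n)"
proof (intro conjI allI impI)
  show "h_count 1 = 0" by (rule h_count_1)
  show "g_count 1 = 0" by (rule g_count_1)
next
  fix n :: nat assume n: "n \<ge> 1"
  show "real (h_count (n + 1)) = catalan n"
    by (simp only: h_count_ballot[OF n] ballot_diagonal)
  show "real (f_count n) = catalan n"
    by (simp only: f_count_ballot[OF n] ballot_diagonal)
  have "real (g_count (n + 1)) + real (ballot n n) = real (ballot (n + 1) (n + 1))"
    using g_count_ballot[OF n] by (simp only: of_nat_add[symmetric])
  thus "real (g_count (n + 1)) = catalan (n + 1) - catalan n"
    unfolding ballot_diagonal by simp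
qed

end
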